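(* Let $H$ be a graph with a critical edge and $\chi(H)=k+1\ge 3$, and suppose that $H$ is a subgraph of $M_k(a,a,1)$ for some positive integer $a$. Let $f:\mathbb{N}\to\mathbb{R}_{\ge 0}$ be a function with $f(n)=o(n^2)$. Then there is a constant $C$ (depending on $H$ and $f$) such that for all sufficiently large $n$ the following holds: if $G$ is an $H$-free graph on $n$ vertices with $e(G)\ge t_k(n)-f(n)$, then $G$ can be made $k$-partite by deleting at most $C\, n^{-2} f(n)^{2}$ edges.
   Context: An edge $e$ of a graph $H$ is critical if $\chi(H-e)=\chi(H)-1$. $t_k(n)$ is the number of edges of the complete $k$-partite graph on $n$ vertices with class sizes as equal as possible. For disjoint vertex sets $A,B$, $K[A,B]=\{ab: a\in A, b\in B\}$. The blown-up Mycielskian graph $M_k(a,b,c)$: let $V_1,\dots,V_k$ be sets of size $a$, $W_1,\dots,W_k$ sets of size $b$, and $U$ a set of size $c$, all pairwise disjoint; $M_k(a,b,c)$ has vertex set $\bigcup_i V_i\cup\bigcup_i W_i\cup U$ and edge set $\bigcup_{i\ne j}K[V_i,V_j]\cup\bigcup_{i\ne j}K[V_i,W_j]\cup\bigcup_i K[W_i,U]$. A graph is $k$-partite if its vertex set can be partitioned into $k$ classes with no edge inside a class. *)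

theory Defs
  imports Complex_Main "HOL-Library.Landau_Symbols" "HOL-Library.Disjoint_Sets"
begin

datatype 'a graph = Graph (verts: "'a set") (edges: "'a set set")

definition simple_graph :: "'a graph \<Rightarrow> bool" where
  "simple_graph G \<longleftrightarrow>
     finite (verts G) \<and> (\<forall>e\<in>edges G. e \<subseteq> verts G \<and> card e = 2)"

definition delete_edges :: "'a graph \<Rightarrow> 'a set set \<Rightarrow> 'a graph" where
  "delete_edges G F = Graph (verts G) (edges G - F)"

definition proper_colouring :: "'a graph \<Rightarrow> nat \<Rightarrow> ('a \<Rightarrow> nat) \<Rightarrow> bool" where
  "proper_colouring G k c \<longleftrightarrow>
     c ` verts G \<subseteq> {..<k} \<and> (\<forall>u v. {u, v} \<in> edges G \<longrightarrow> c u \<noteq> c v)"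

definition chromatic_number :: "'a graph \<Rightarrow> nat" where
  "chromatic_number G = (LEAST k. \<exists>c. proper_colouring G k c)"

text \<open>Written with \<open>+ 1\<close> on the left so that no truncated subtraction occurs.\<close>

definition critical_edge :: "'a graph \<Rightarrow> 'a set \<Rightarrow> bool" where
  "critical_edge H e \<longleftrightarrow>
     e \<in> edges H \<and> chromatic_number (delete_edges H {e}) + 1 = chromatic_number H"

text \<open>The classes are allowed to be empty.\<close>

definition k_partite :: "nat \<Rightarrow> 'a graph \<Rightarrow> bool" where
  "k_partite k G \<longleftrightarrow>
     (\<exists>P :: nat \<Rightarrow> 'a set.
        (\<Union>i<k. P i) = verts G \<and> disjoint_family_on P {..<k} \<and>
        (\<forall>i<k. \<forall>e\<in>edges G. \<not> e \<subseteq> P i))"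

text \<open>Subgraphs are taken up to isomorphism and need not be induced.\<close>

definition is_subgraph :: "'a graph \<Rightarrow> 'b graph \<Rightarrow> bool" where
  "is_subgraph H G \<longleftrightarrow>
     (\<exists>\<phi>. inj_on \<phi> (verts H) \<and> \<phi> ` verts H \<subseteq> verts G \<and>
          (\<forall>e\<in>edges H. \<phi> ` e \<in> edges G))"

definition free_of :: "'a graph \<Rightarrow> 'b graph \<Rightarrow> bool" where
  "free_of H G \<longleftrightarrow> \<not> is_subgraph H G"

text \<open>The classes are the residue classes modulo \<open>k\<close> in \<open>{..<n}\<close>, whose sizes pairwise
  differ by at most one.\<close>

definition turan_graph :: "nat \<Rightarrow> nat \<Rightarrow> nat graph" where
  "turan_graph k n =
     Graph {..<n} {{u, v} | u v. u < n \<and> v < n \<and> u mod k \<noteq> v mod k}"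

definition turan_number :: "nat \<Rightarrow> nat \<Rightarrow> nat" where
  "turan_number k n = card (edges (turan_graph k n))"

definition complete_between :: "'a set \<Rightarrow> 'a set \<Rightarrow> 'a set set" where
  "complete_between A B = {{x, y} | x y. x \<in> A \<and> y \<in> B}"

text \<open>\<open>MV i j\<close> and \<open>MW i j\<close> are the \<open>j\<close>-th vertices of the classes \<open>V\<^sub>i\<close> and \<open>W\<^sub>i\<close>,
  where \<open>i\<close> runs through \<open>0, \<dots>, k - 1\<close>.\<close>

datatype mycielskian_vertex = MV nat nat | MW nat nat | MU nat

definition blown_up_mycielskian ::
  "nat \<Rightarrow> nat \<Rightarrow> nat \<Rightarrow> nat \<Rightarrow> mycielskian_vertex graph" where
  "blown_up_mycielskian k a b c =
     (let V = (\<lambda>i. MV i ` {..<a}); W = (\<lambda>i. MW i ` {..<b}); U = MU ` {..<c} in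
      Graph ((\<Union>i<k. V i) \<union> (\<Union>i<k. W i) \<union> U)
        ((\<Union>i<k. \<Union>j\<in>{..<k} - {i}. complete_between (V i) (V j)) \<union>
         (\<Union>i<k. \<Union>j\<in>{..<k} - {i}. complete_between (V i) (W j)) \<union>
         (\<Union>i<k. complete_between (W i) U)))"

end

theory Submission
  imports Defs
begin

text \<open>
  An \<open>H\<close>-free graph contains neither \<open>K\<close>, the complete \<open>k\<close>-partite graph with classes of bounded
  size plus one edge inside a class, nor \<open>M\<^sub>k(t, t, 1)\<close>.

  Stability. A vertex set \<open>S\<close> maximising \<open>2 e(S) - \<beta> |S| (|S| + 1)\<close> induces a graph of minimum degree at
  least \<open>\<beta> |S|\<close>, which contains a large complete \<open>k\<close>-partite graph with classes \<open>D\<^sub>0, \<dots>, D\<^bsub>k-1\<^esub>\<close>. As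
  \<open>K\<close> is excluded, every vertex has few neighbours in some \<open>D\<^sub>i\<close>; counting degrees, almost all
  vertices are joined to most of all the other classes, and two such vertices with the same \<open>i\<close> are not
  adjacent. So \<open>G\<close> is close to \<open>k\<close>-partite.

  Refinement. Take a \<open>k\<close>-partition with the fewest inner edges, and let \<open>B\<close> be the set of the vertices that
  miss at least \<open>\<gamma> n\<close> vertices of other classes. Vertices outside \<open>B\<close> can be extended greedily
  to complete \<open>k\<close>-partite graphs. Hence every inner edge meets \<open>B\<close>, since \<open>K\<close> is excluded. A vertex with
  more than \<open>|B| + t\<close> neighbours in its own class has as many in every class, by the choice of the
  partition, and would be the apex of an \<open>M\<^sub>k(t, t, 1)\<close>. So there are at most \<open>|B| (|B| + t)\<close> inner edges,
  while the edge count forces \<open>\<gamma> n |B| = O(f(n))\<close>.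
\<close>

section \<open>Finite graphs as symmetric relations, and the excluded configurations\<close>

locale fgraph =
  fixes V :: "'b set" and E :: "'b \<Rightarrow> 'b \<Rightarrow> bool"
  assumes finite_V: "finite V"
    and E_sym: "E x y \<Longrightarrow> E y x"
    and E_irrefl: "\<not> E x x"
    and E_V: "E x y \<Longrightarrow> x \<in> V"

text \<open>Disjointness of the classes is not demanded: with an irreflexive \<open>E\<close>, a
  common vertex of two classes would be adjacent to itself. Edges inside a class are allowed, since
  subgraphs need not be induced.\<close>

definition multipartite ::
  "'b set \<Rightarrow> ('b \<Rightarrow> 'b \<Rightarrow> bool) \<Rightarrow> nat \<Rightarrow> nat \<Rightarrow> (nat \<Rightarrow> 'b set) \<Rightarrow> bool" where
  "multipartite V E r t D \<longleftrightarrow>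
     (\<forall>i<r. D i \<subseteq> V \<and> card (D i) = t) \<and>
     (\<forall>i<r. \<forall>j<r. i \<noteq> j \<longrightarrow> (\<forall>x\<in>D i. \<forall>y\<in>D j. E x y))"

text \<open>Excludes the complete \<open>k\<close>-partite graph with one additional edge \<open>xy\<close> inside its \<open>i\<close>-th
  class \<open>D i \<union> {x, y}\<close>. Every graph of chromatic number \<open>k + 1\<close> with a critical edge embeds into
  it once \<open>t\<close> is at least the number of its vertices.\<close>

definition crit_free :: "'b set \<Rightarrow> ('b \<Rightarrow> 'b \<Rightarrow> bool) \<Rightarrow> nat \<Rightarrow> nat \<Rightarrow> bool" where
  "crit_free V E k t \<longleftrightarrow>
     (\<nexists>x y i D. i < k \<and> E x y \<and> multipartite V E k t D \<and>
        (\<forall>j<k. x \<notin> D j \<and> y \<notin> D j) \<and>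
        (\<forall>j<k. j \<noteq> i \<longrightarrow> (\<forall>w\<in>D j. E x w \<and> E y w)))"

text \<open>Ordered pairs are counted, so every edge contributes twice. The extremal density in this
  normalisation is \<open>1 - 1 / k\<close>, without a factor one half.\<close>

definition arcs :: "('b \<Rightarrow> 'b \<Rightarrow> bool) \<Rightarrow> 'b set \<Rightarrow> nat" where
  "arcs E S = card {(x, y). x \<in> S \<and> y \<in> S \<and> E x y}"

text \<open>Constructions only have to supply classes with at least \<open>t\<close> vertices; here
  they are cut down to exactly \<open>t\<close>.\<close>

lemma multipartite_subsets:
  assumes "\<And>i. i < r \<Longrightarrow> C i \<subseteq> V \<and> t \<le> card (C i)"
    and "\<And>i j x y. i < r \<Longrightarrow> j < r \<Longrightarrow> i \<noteq> j \<Longrightarrow> x \<in> C i \<Longrightarrow> y \<in> C j \<Longrightarrow> E x y"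
  obtains D where "multipartite V E r t D" "\<And>i. i < r \<Longrightarrow> D i \<subseteq> C i"
proof -
  have "\<exists>B. B \<subseteq> C i \<and> card B = t" if "i < r" for i
    by (meson assms(1) obtain_subset_with_card_n that)
  then obtain D where D: "\<And>i. i < r \<Longrightarrow> D i \<subseteq> C i \<and> card (D i) = t"
    by metis
  show thesis
  proof (rule that)
    show "multipartite V E r t D"
      unfolding multipartite_def
    proof (intro conjI allI impI ballI)
      fix i j x y assume "i < r" "j < r" "i \<noteq> j" "x \<in> D i" "y \<in> D j"
      then show "E x y" using D assms(2)[of i j x y] by blast
    next
      fix i assume "i < r"
      then show "D i \<subseteq> V" "card (D i) = t" using D[of i] assms(1)[of i] by auto
    qed
  qed (simp add: D)
qed

text \<open>Shrinking the classes preserves all required adjacencies, so a contradiction to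
  \<open>crit_free\<close> already follows from classes of size at least \<open>t\<close>.\<close>

lemma crit_freeD:
  assumes "crit_free V E k t" "i < k" "E x y"
    and "\<And>j. j < k \<Longrightarrow> C j \<subseteq> V \<and> t \<le> card (C j)"
    and "\<And>i j x y. i < k \<Longrightarrow> j < k \<Longrightarrow> i \<noteq> j \<Longrightarrow> x \<in> C i \<Longrightarrow> y \<in> C j \<Longrightarrow> E x y"
    and "\<And>j. j < k \<Longrightarrow> x \<notin> C j \<and> y \<notin> C j"
    and "\<And>j w. j < k \<Longrightarrow> j \<noteq> i \<Longrightarrow> w \<in> C j \<Longrightarrow> E x w \<and> E y w"
  shows False
proof -
  obtain D where D: "multipartite V E k t D" "\<And>i. i < k \<Longrightarrow> D i \<subseteq> C i"
    by (rule multipartite_subsets[of k C V t E]) (use assms(4,5) in blast)+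
  have "\<forall>j<k. x \<notin> D j \<and> y \<notin> D j"
    using D(2) assms(6) by blast
  moreover have "\<forall>j<k. j \<noteq> i \<longrightarrow> (\<forall>w\<in>D j. E x w \<and> E y w)"
    using D(2) assms(7) by blast
  ultimately show False
    using assms(1-3) D(1) unfolding crit_free_def by blast
qed

section \<open>Double counting, and large complete multipartite subgraphs\<close>

context fgraph
begin

lemma E_commute: "E x y \<longleftrightarrow> E y x"
  using E_sym by blast

lemma nbh_subset: "Collect (E v) \<subseteq> V"
  using E_V E_sym by blast

lemma finite_nbh [simp]: "finite (Collect (E v))"
  using nbh_subset finite_V finite_subset by blast

lemma sum_card_nbh_swap:
  assumes "finite A" "finite B"
  shows "(\<Sum>a\<in>A. card (Collect (E a) \<inter> B)) = (\<Sum>b\<in>B. card (Collect (E b) \<inter> A))"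
proof -
  have "card (Collect (E a) \<inter> B) = (\<Sum>b\<in>B. if E a b then 1 else 0)" if "finite B" for a B
    using that by (simp add: sum.If_cases Int_commute)
  moreover have "(\<Sum>a\<in>A. \<Sum>b\<in>B. if E a b then 1 else 0)
      = (\<Sum>b\<in>B. \<Sum>a\<in>A. if E b a then 1 else (0::nat))"
    by (subst sum.swap) (intro sum.cong refl if_cong E_commute)
  ultimately show ?thesis
    by (simp only: assms)
qed

lemma multipartite_disjoint:
  assumes "multipartite V E r t D" "i < r" "j < r" "i \<noteq> j"
  shows "D i \<inter> D j = {}"
  using assms E_irrefl unfolding multipartite_def by blast

lemma multipartite_finite:
  assumes "multipartite V E r t D" "i < r"
  shows "finite (D i)"
  using assms finite_subset[OF _ finite_V, of "D i"] unfolding multipartite_def by simp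

lemma multipartite_card_Union:
  assumes D: "multipartite V E r t D"
  shows "card (\<Union>i<r. D i) = r * t"
proof -
  have "card (\<Union>i<r. D i) = (\<Sum>i<r. card (D i))"
    by (rule card_UN_disjoint) (use multipartite_disjoint[OF D] multipartite_finite[OF D] in auto)
  then show ?thesis
    using D by (simp add: multipartite_def)
qed

text \<open>Double counting of the adjacent pairs between \<open>V\<close> and the union of the
  classes, which has \<open>r * T\<close> vertices. Combined with upper bounds on the traces of
  single vertices, it limits how many vertices can have a small trace.\<close>

lemma multipartite_degree_sum:
  fixes \<theta> :: real
  assumes D: "multipartite V E r T D"
    and deg: "\<And>v. v \<in> V \<Longrightarrow> real (card (Collect (E v))) \<ge> (1 - \<theta>) * card V"
  shows "real r * T * ((1 - \<theta>) * card V) \<le> (\<Sum>v\<in>V. real (card (Collect (E v) \<inter> (\<Union>i<r. D i))))"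
proof -
  define A where "A = (\<Union>i<r. D i)"
  have AV: "A \<subseteq> V"
    using D unfolding A_def multipartite_def by blast
  have fA: "finite A"
    using AV finite_V finite_subset by blast
  have cA: "card A = r * T"
    unfolding A_def by (rule multipartite_card_Union[OF D])
  have "real r * T * ((1 - \<theta>) * card V) = (\<Sum>a\<in>A. (1 - \<theta>) * card V)"
    by (simp add: cA)
  also have "\<dots> \<le> (\<Sum>a\<in>A. real (card (Collect (E a) \<inter> V)))"
    using deg AV by (intro sum_mono) (auto simp: Int_absorb2[OF nbh_subset])
  also have "\<dots> = real (\<Sum>a\<in>A. card (Collect (E a) \<inter> V))"
    by simp
  also have "\<dots> = real (\<Sum>v\<in>V. card (Collect (E v) \<inter> A))"
    using sum_card_nbh_swap[OF fA finite_V] by simp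
  finally show ?thesis
    by (simp add: A_def)
qed

text \<open>Apart from \<open>D i\<close> and \<open>D j\<close> there are \<open>r - 2\<close>
  classes, each contributing at most \<open>T\<close>. Read backwards: a vertex with few neighbours
  in \<open>D i\<close> but a large trace sees most of every other class \<open>D j\<close>.\<close>

lemma multipartite_trace_le_pair:
  assumes D: "multipartite V E r T D" and i: "i < r" "card (Collect (E v) \<inter> D i) \<le> s"
    and J: "j < r" "j \<noteq> i"
  shows "card (Collect (E v) \<inter> (\<Union>i<r. D i)) + 2 * T \<le> r * T + s + card (Collect (E v) \<inter> D j)"
proof -
  have "card (Collect (E v) \<inter> (\<Union>i<r. D i)) = card (\<Union>i<r. Collect (E v) \<inter> D i)"
    by (simp only: Int_UN_distrib)
  also have "\<dots> \<le> (\<Sum>l<r. card (Collect (E v) \<inter> D l))"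
    by (rule card_UN_le) simp
  also have "\<dots> = card (Collect (E v) \<inter> D i) + card (Collect (E v) \<inter> D j)
      + (\<Sum>l\<in>{..<r} - {i} - {j}. card (Collect (E v) \<inter> D l))"
    using i J by (simp add: sum.remove[of "{..<r}" i] sum.remove[of "{..<r} - {i}" j])
  also have "(\<Sum>l\<in>{..<r} - {i} - {j}. card (Collect (E v) \<inter> D l))
      \<le> (\<Sum>l\<in>{..<r} - {i} - {j}. T)"
  proof (rule sum_mono)
    fix l assume "l \<in> {..<r} - {i} - {j}"
    then show "card (Collect (E v) \<inter> D l) \<le> T"
      using D multipartite_finite[OF D, of l] unfolding multipartite_def
      by (metis Diff_iff Int_lower2 card_mono lessThan_iff)
  qed
  also have "\<dots> = (r - 2) * T"
    using i J by (simp add: card_Diff_subset numeral_2_eq_2)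
  finally show ?thesis
    using i J by (cases r; cases "r - 1") auto
qed

lemma multipartite_trace_le:
  assumes D: "multipartite V E r T D" and i: "i < r" "card (Collect (E v) \<inter> D i) \<le> s"
  shows "card (Collect (E v) \<inter> (\<Union>i<r. D i)) + T \<le> r * T + s"
proof -
  have "card (Collect (E v) \<inter> (\<Union>i<r. D i)) = card (\<Union>i<r. Collect (E v) \<inter> D i)"
    by (simp only: Int_UN_distrib)
  also have "\<dots> \<le> (\<Sum>l<r. card (Collect (E v) \<inter> D l))"
    by (rule card_UN_le) simp
  also have "\<dots> = card (Collect (E v) \<inter> D i)
      + (\<Sum>l\<in>{..<r} - {i}. card (Collect (E v) \<inter> D l))"
    using i by (simp add: sum.remove[of "{..<r}" i])
  also have "(\<Sum>l\<in>{..<r} - {i}. card (Collect (E v) \<inter> D l)) \<le> (\<Sum>l\<in>{..<r} - {i}. T)"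
  proof (rule sum_mono)
    fix l assume "l \<in> {..<r} - {i}"
    then show "card (Collect (E v) \<inter> D l) \<le> T"
      using D multipartite_finite[OF D, of l] unfolding multipartite_def
      by (metis Diff_iff Int_lower2 card_mono lessThan_iff)
  qed
  also have "\<dots> = (r - 1) * T"
    using i by simp
  finally show ?thesis
    using i by (cases r) auto
qed

text \<open>Induction step of an Erdos-Stone argument. A vertex outside \<open>Y\<close> has few
  neighbours in some class, hence a small trace on \<open>A\<close>, so degree counting makes
  \<open>Y\<close> large. Then \<open>T\<close> vertices of \<open>Y\<close> have the same trace
  \<open>B\<close>; they form the new class, and every old class is cut down to its part in
  \<open>B\<close>.\<close>

lemma multipartite_extend:
  fixes \<theta> :: real
  assumes D: "multipartite V E r T' D"
    and deg: "\<And>v. v \<in> V \<Longrightarrow> real (card (Collect (E v))) \<ge> (1 - \<theta>) * card V"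
    and T': "real T + 1 \<le> T' * (1 - r * \<theta>)"
    and n: "card V \<ge> T' * (T * 2 ^ (r * T'))"
  shows "\<exists>D. multipartite V E (Suc r) T D"
proof -
  define A where "A = (\<Union>i<r. D i)"
  have AV: "A \<subseteq> V"
    using D unfolding A_def multipartite_def by blast
  have fA: "finite A"
    using AV finite_V finite_subset by blast
  have cA: "card A = r * T'"
    unfolding A_def by (rule multipartite_card_Union[OF D])
  define Y where "Y = {v \<in> V. \<forall>i<r. T \<le> card (Collect (E v) \<inter> D i)}"
  have YV: "Y \<subseteq> V" and fY: "finite Y"
    using finite_V by (auto simp: Y_def)
  have le1: "real (card (Collect (E v) \<inter> A)) \<le> r * T'" for v
    using card_mono[OF fA, of "Collect (E v) \<inter> A"] cA by (metis Int_lower2 of_nat_le_iff of_nat_mult)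
  have le2: "real (card (Collect (E v) \<inter> A)) \<le> real r * T' + T - T'" if v: "v \<in> V - Y" for v
  proof -
    obtain i where "i < r" "card (Collect (E v) \<inter> D i) \<le> T"
    proof -
      have "\<exists>i<r. \<not> T \<le> card (Collect (E v) \<inter> D i)"
        using v by (auto simp: Y_def)
      then show thesis using that by (meson nat_le_linear)
    qed
    then have "card (Collect (E v) \<inter> A) + T' \<le> r * T' + T"
      unfolding A_def by (rule multipartite_trace_le[OF D])
    then have "real (card (Collect (E v) \<inter> A) + T') \<le> real (r * T' + T)"
      by (rule of_nat_mono)
    then show ?thesis by simp
  qed
  have "real r * T' * ((1 - \<theta>) * card V) \<le> (\<Sum>v\<in>V. real (card (Collect (E v) \<inter> A)))"
    unfolding A_def by (rule multipartite_degree_sum[OF D deg])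
  also have "\<dots> = (\<Sum>v\<in>V-Y. real (card (Collect (E v) \<inter> A))) + (\<Sum>v\<in>Y. real (card (Collect (E v) \<inter> A)))"
    by (rule sum.subset_diff[OF YV finite_V])
  also have "\<dots> \<le> (\<Sum>v\<in>V-Y. (real r * T' + T - T')) + (\<Sum>v\<in>Y. real r * T')"
    using le1 le2 by (intro add_mono sum_mono) auto
  also have "\<dots> = (real (card V) - card Y) * (real r * T' + T - T') + card Y * (real r * T')"
    using YV finite_V by (simp add: card_Diff_subset fY of_nat_diff card_mono)
  \<comment> \<open>By \<open>T'\<close> the factor of \<open>card V\<close> is at least 1, and that
    of \<open>card Y\<close> is at most \<open>T'\<close>. Hence \<open>Y\<close> contains at least
    a fraction \<open>1 / T'\<close> of all vertices.\<close>
  finally have "card V * (T' * (1 - r * \<theta>) - T) \<le> card Y * (real T' - T)"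
    by (simp add: algebra_simps)
  moreover have "real (card V) * 1 \<le> card V * (T' * (1 - r * \<theta>) - T)"
    using T' by (intro mult_left_mono) auto
  moreover have "card Y * (real T' - T) \<le> real (card Y) * T'"
    by (intro mult_left_mono) auto
  ultimately have "real (card V) \<le> real (card Y * T')"
    by simp
  then have "card V \<le> T' * card Y"
    by (simp only: of_nat_le_iff mult.commute[of T'])
  then have "T' * (T * 2 ^ (r * T')) \<le> T' * card Y"
    using n by (rule le_trans[rotated])
  moreover have "T' > 0"
    using T' by (cases T') auto
  ultimately have cY: "T * 2 ^ (r * T') \<le> card Y"
    by simp
  \<comment> \<open>Pigeonhole over the \<open>2 ^ (r * T')\<close> possible traces on
    \<open>A\<close>.\<close>
  have "\<exists>B\<in>Pow A. T \<le> card {v \<in> Y. Collect (E v) \<inter> A = B}"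
  proof (rule ccontr)
    assume *: "\<not> ?thesis"
    have eq: "(\<Union>B\<in>Pow A. {v \<in> Y. Collect (E v) \<inter> A = B}) = Y" (is "?U = Y")
    proof (intro equalityI subsetI)
      fix v assume "v \<in> Y"
      then show "v \<in> ?U" by (intro UN_I[of "Collect (E v) \<inter> A"]) simp_all
    qed (elim UN_E CollectE conjE)
    have "card (\<Union>B\<in>Pow A. {v \<in> Y. Collect (E v) \<inter> A = B})
        \<le> (\<Sum>B\<in>Pow A. card {v \<in> Y. Collect (E v) \<inter> A = B})"
      by (rule card_UN_le) (simp add: fA)
    then have "card Y \<le> (\<Sum>B\<in>Pow A. card {v \<in> Y. Collect (E v) \<inter> A = B})"
      unfolding eq .
    also have "\<dots> < (\<Sum>B\<in>Pow A. T)"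
      using * fA by (intro sum_strict_mono) (auto simp: not_le)
    also have "\<dots> = T * 2 ^ (r * T')"
      by (simp add: card_Pow fA cA)
    finally show False using cY by simp
  qed
  then obtain B where "B \<subseteq> A" "T \<le> card {v \<in> Y. Collect (E v) \<inter> A = B}"
    by blast
  then obtain W where W: "W \<subseteq> {v \<in> Y. Collect (E v) \<inter> A = B}" "card W = T"
    by (meson obtain_subset_with_card_n)
  define C where "C i = (if i = r then W else B \<inter> D i)" for i
  have EW: "E x y" if "x \<in> W" "y \<in> B" for x y
    using W that by blast
  have "\<exists>D. multipartite V E (Suc r) T D"
  proof (rule multipartite_subsets[of "Suc r" C V T E])
    fix i assume i: "i < Suc r"
    show "C i \<subseteq> V \<and> T \<le> card (C i)"
    proof (cases "i = r")
      case True
      then show ?thesis using W YV by (auto simp: C_def)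
    next
      case False
      then have ir: "i < r" using i by simp
      \<comment> \<open>A vertex of \<open>W\<close> witnesses that \<open>B\<close> is the trace of
        a member of \<open>Y\<close>. For \<open>T = 0\<close> the set \<open>W\<close> is empty,
        but then the bound is trivial.\<close>
      have "T \<le> card (B \<inter> D i)"
      proof (cases "T = 0")
        case False
        then obtain v where "v \<in> W" using W by fastforce
        then have v: "v \<in> Y" "Collect (E v) \<inter> A = B" using W by auto
        have "Collect (E v) \<inter> D i = B \<inter> D i"
          using v(2) ir unfolding A_def by blast
        then show ?thesis using v(1) ir unfolding Y_def by auto
      qed simp
      then show ?thesis
        using False AV \<open>B \<subseteq> A\<close> by (auto simp: C_def)
    qed
  next
    fix i j x y assume "i < Suc r" "j < Suc r" "i \<noteq> j" "x \<in> C i" "y \<in> C j"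
    then show "E x y"
      using EW E_sym D unfolding C_def multipartite_def
      by (auto split: if_splits simp: less_Suc_eq)
  qed blast
  then show ?thesis .
qed

lemma fgraph_induced: "S \<subseteq> V \<Longrightarrow> fgraph S (\<lambda>x y. E x y \<and> x \<in> S \<and> y \<in> S)"
  by unfold_locales (use finite_V finite_subset E_sym E_irrefl in blast)+

end

text \<open>Induction on the number of classes, with \<open>T\<close> arbitrary:
  \<open>r + 1\<close> classes of size \<open>T\<close> are carved out of \<open>r\<close> classes
  of a larger size \<open>T'\<close>. This step requires \<open>r * \<theta> < 1\<close>, so the
  assumption lists one such condition per step.\<close>

lemma multipartite_exists:
  fixes \<theta> :: real
  assumes "\<And>i. i < r \<Longrightarrow> real i * \<theta> < 1"
  shows "\<exists>n0. \<forall>(V :: 'b set) E. fgraph V E \<longrightarrow> n0 \<le> card V \<longrightarrow>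
           (\<forall>v\<in>V. (1 - \<theta>) * card V \<le> real (card (Collect (E v)))) \<longrightarrow>
           (\<exists>D. multipartite V E r T D)"
  using assms
proof (induction r arbitrary: T)
  case 0
  show ?case by (auto simp: multipartite_def)
next
  case (Suc r)
  have "1 - r * \<theta> > 0" using Suc.prems[of r] by simp
  then obtain T' :: nat where "(real T + 1) / (1 - r * \<theta>) \<le> T'"
    using real_arch_simple by blast
  then have T': "real T + 1 \<le> T' * (1 - r * \<theta>)"
    using \<open>1 - r * \<theta> > 0\<close> by (simp add: field_simps)
  obtain n0 where n0: "\<forall>(V :: 'b set) E. fgraph V E \<longrightarrow> n0 \<le> card V \<longrightarrow>
           (\<forall>v\<in>V. (1 - \<theta>) * card V \<le> real (card (Collect (E v)))) \<longrightarrow>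
           (\<exists>D. multipartite V E r T' D)"
    using Suc.IH[of T'] Suc.prems by (metis less_SucI)
  show ?case
  proof (intro exI[of _ "n0 + T' * (T * 2 ^ (r * T'))"] allI impI)
    fix V :: "'b set" and E
    assume G: "fgraph V E" and n: "n0 + T' * (T * 2 ^ (r * T')) \<le> card V"
      and deg: "\<forall>v\<in>V. (1 - \<theta>) * card V \<le> real (card (Collect (E v)))"
    obtain D where D: "multipartite V E r T' D"
      using n0 G n deg by (meson add_leD1)
    show "\<exists>D. multipartite V E (Suc r) T D"
      by (rule fgraph.multipartite_extend[OF G D]) (use deg T' n in auto)
  qed
qed

section \<open>Subgraphs of large minimum degree and their structure\<close>

context fgraph
begin

lemma finite_arcs: "finite S \<Longrightarrow> finite {(x, y). x \<in> S \<and> y \<in> S \<and> E x y}"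
  by (rule finite_subset[of _ "S \<times> S"]) auto

lemma arcs_remove:
  assumes "finite S" "v \<in> S"
  shows "arcs E S = arcs E (S - {v}) + 2 * card (Collect (E v) \<inter> S)"
proof -
  let ?N = "Collect (E v) \<inter> S" and ?R = "{(x, y). x \<in> S - {v} \<and> y \<in> S - {v} \<and> E x y}"
  have *: "{(x, y). x \<in> S \<and> y \<in> S \<and> E x y} = ?R \<union> ({v} \<times> ?N \<union> ?N \<times> {v})"
    using assms E_commute by auto
  have "card ({v} \<times> ?N \<union> ?N \<times> {v}) = card ({v} \<times> ?N) + card (?N \<times> {v})"
    using assms E_irrefl by (intro card_Un_disjoint) auto
  then have "card (?R \<union> ({v} \<times> ?N \<union> ?N \<times> {v})) = card ?R + 2 * card ?N"
    using assms finite_arcs[of "S - {v}"] by (subst card_Un_disjoint) auto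
  then show ?thesis
    unfolding arcs_def * .
qed

lemma arcs_le: "finite S \<Longrightarrow> real (arcs E S) \<le> real (card S) ^ 2"
proof -
  assume "finite S"
  then have "arcs E S \<le> card (S \<times> S)"
    unfolding arcs_def by (intro card_mono) auto
  then show ?thesis
    by (simp add: card_cartesian_product power2_eq_square flip: of_nat_mult)
qed

text \<open>Deleting a vertex from a maximiser of the potential cannot increase it, which is a
  minimum degree condition.\<close>

lemma min_degree_subset:
  fixes \<beta> :: real
  obtains S where "S \<subseteq> V"
    and "arcs E V - \<beta> * card V * (real (card V) + 1) \<le> arcs E S - \<beta> * card S * (real (card S) + 1)"
    and "\<And>v. v \<in> S \<Longrightarrow> \<beta> * card S \<le> card (Collect (E v) \<inter> S)"
proof -
  \<comment> \<open>The penalty \<open>\<beta> * s * (s + 1)\<close> drops by exactly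
    \<open>2 * \<beta> * s\<close> when a vertex leaves a set of size \<open>s\<close>, while
    \<open>arcs\<close> drops by twice the degree of that vertex.\<close>
  define g where "g S = arcs E S - \<beta> * card S * (real (card S) + 1)" for S
  have fin: "finite (g ` Pow V)" using finite_V by simp
  then have "Max (g ` Pow V) \<in> g ` Pow V" by (intro Max_in) auto
  then obtain S where S: "S \<subseteq> V" "g S = Max (g ` Pow V)" by force
  have mx: "g R \<le> g S" if "R \<subseteq> V" for R
    using that S fin by simp
  show thesis
  proof (rule that[OF S(1)])
    show "arcs E V - \<beta> * card V * (real (card V) + 1) \<le> arcs E S - \<beta> * card S * (real (card S) + 1)"
      using mx[of V] by (simp add: g_def)
    fix v assume v: "v \<in> S"
    have fS: "finite S" using S finite_V finite_subset by blast
    then have c: "real (card S) = real (card (S - {v})) + 1"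
      using v card_Suc_Diff1[of S v] by linarith
    have "g (S - {v}) \<le> g S" using mx S by blast
    then show "\<beta> * card S \<le> card (Collect (E v) \<inter> S)"
      unfolding g_def c using arcs_remove[OF fS v] by (simp add: algebra_simps)
  qed
qed

text \<open>Otherwise \<open>v\<close> and one of its neighbours \<open>y\<close> in
  \<open>D 0\<close> would be the additional edge: \<open>y\<close> is joined to all other classes
  because it belongs to \<open>D 0\<close>, and \<open>v\<close> is joined to its own
  neighbourhoods. Removing \<open>y\<close> costs one vertex, hence the threshold
  \<open>t + 1\<close>.\<close>

lemma crit_free_trace:
  assumes cf: "crit_free V E k t" and k: "k \<ge> 1" and D: "multipartite V E k T D"
  shows "\<exists>i<k. card (Collect (E v) \<inter> D i) \<le> t"
proof (rule ccontr)
  assume "\<not> ?thesis"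
  then have *: "t + 1 \<le> card (Collect (E v) \<inter> D i)" if "i < k" for i
    using that by (metis Suc_eq_plus1 not_less_eq_eq)
  have "Collect (E v) \<inter> D 0 \<noteq> {}"
    using *[of 0] k by fastforce
  then obtain y where y: "E v y" "y \<in> D 0" by blast
  show False
  proof (rule crit_freeD[OF cf, of 0 v y "\<lambda>j. Collect (E v) \<inter> D j - {y}"])
    show "0 < k" using k by simp
    show "E v y" by fact
  next
    fix j assume j: "j < k"
    have "card (Collect (E v) \<inter> D j) - 1 \<le> card (Collect (E v) \<inter> D j - {y})"
      using diff_card_le_card_Diff[of "{y}" "Collect (E v) \<inter> D j"] by simp
    then show "Collect (E v) \<inter> D j - {y} \<subseteq> V \<and> t \<le> card (Collect (E v) \<inter> D j - {y})"
      using *[OF j] nbh_subset by auto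
  next
    fix i j x z assume "i < k" "j < k" "i \<noteq> j"
      "x \<in> Collect (E v) \<inter> D i - {y}" "z \<in> Collect (E v) \<inter> D j - {y}"
    then show "E x z" using D unfolding multipartite_def by blast
  next
    fix j assume "j < k"
    show "v \<notin> Collect (E v) \<inter> D j - {y} \<and> y \<notin> Collect (E v) \<inter> D j - {y}"
      using E_irrefl by blast
  next
    fix j w assume "j < k" "j \<noteq> 0" "w \<in> Collect (E v) \<inter> D j - {y}"
    then show "E v w \<and> E y w" using D y k unfolding multipartite_def
      by (metis (no_types, lifting) DiffD1 IntE le_zero_eq linorder_not_le mem_Collect_eq not_one_le_zero)
  qed
qed

lemma crit_free_induced:
  assumes "crit_free V E k t" "S \<subseteq> V"
  shows "crit_free S (\<lambda>x y. E x y \<and> x \<in> S \<and> y \<in> S) k t"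
  unfolding crit_free_def
proof clarify
  fix x y i D
  assume *: "i < k" "multipartite S (\<lambda>x y. E x y \<and> x \<in> S \<and> y \<in> S) k t D" "E x y"
    "\<forall>j<k. x \<notin> D j \<and> y \<notin> D j"
    "\<forall>j<k. j \<noteq> i \<longrightarrow> (\<forall>w\<in>D j. (E x w \<and> x \<in> S \<and> w \<in> S) \<and> E y w \<and> y \<in> S \<and> w \<in> S)"
  have m: "\<forall>i<k. D i \<subseteq> S \<and> card (D i) = t" "\<forall>i<k. \<forall>j<k. i \<noteq> j \<longrightarrow> (\<forall>x\<in>D i. \<forall>y\<in>D j. E x y)"
    using *(2) unfolding multipartite_def by simp_all
  have "\<forall>i<k. D i \<subseteq> V \<and> t \<le> card (D i)"
    using m(1) assms(2) by (metis order_refl order_trans)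
  then show False
    by (intro crit_freeD[OF assms(1) *(1,3), of D]) (use m(2) *(4,5) in auto)
qed

text \<open>The label \<open>p v\<close> is a class in which \<open>v\<close> has at most
  \<open>t\<close> neighbours. Every trace is then at most \<open>(k - 1) * T + t\<close>, while the
  average is at least \<open>(k - 1) * T - k * d * T\<close>, so only few vertices fall noticeably
  short of \<open>(k - 1) * T\<close>; these form \<open>X\<close>.\<close>

lemma crit_free_min_degree_structure:
  fixes d :: real
  assumes cf: "crit_free V E k t" and k: "k \<ge> 2" and D: "multipartite V E k T D"
    and deg: "\<And>v. v \<in> V \<Longrightarrow> real (card (Collect (E v))) \<ge> (1 - (1 / k + d)) * card V"
    and T: "4 * t + 8 \<le> T" "real t \<le> d * T"
  obtains X p where "X \<subseteq> V" "real (card X) \<le> 8 * (real k + 1) * d * card V"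
    "\<And>v. p v < k" "\<And>x y. E x y \<Longrightarrow> x \<notin> X \<Longrightarrow> y \<notin> X \<Longrightarrow> p x \<noteq> p y"
proof -
  define A where "A = (\<Union>i<k. D i)"
  define X where "X = {v \<in> V. real (card (Collect (E v) \<inter> A)) < (real k - 1) * T - T / 8}"
  have "\<forall>v. \<exists>i<k. card (Collect (E v) \<inter> D i) \<le> t"
    using crit_free_trace[OF cf _ D] k by simp
  then obtain p where p: "\<And>v. p v < k" "\<And>v. card (Collect (E v) \<inter> D (p v)) \<le> t"
    by metis
  have XV: "X \<subseteq> V" and fX: "finite X"
    using finite_V by (auto simp: X_def)
  have up: "real (card (Collect (E v) \<inter> A)) \<le> (real k - 1) * T + t" for v
  proof -
    have "card (Collect (E v) \<inter> A) + T \<le> k * T + t"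
      unfolding A_def by (rule multipartite_trace_le[OF D p(1)[of v] p(2)])
    then have "real (card (Collect (E v) \<inter> A) + T) \<le> real (k * T + t)"
      by (rule of_nat_mono)
    then show ?thesis by (simp add: algebra_simps)
  qed
  have "((real k - 1) * T - k * d * T) * card V = real k * T * ((1 - (1 / k + d)) * card V)"
    using k by (simp add: field_simps)
  also have "\<dots> \<le> (\<Sum>v\<in>V. real (card (Collect (E v) \<inter> A)))"
    unfolding A_def by (rule multipartite_degree_sum[OF D deg])
  also have "\<dots> = (\<Sum>v\<in>V-X. real (card (Collect (E v) \<inter> A))) + (\<Sum>v\<in>X. real (card (Collect (E v) \<inter> A)))"
    by (rule sum.subset_diff[OF XV finite_V])
  also have "\<dots> \<le> (\<Sum>v\<in>V-X. (real k - 1) * T + t) + (\<Sum>v\<in>X. (real k - 1) * T - T / 8)"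
    using up by (intro add_mono sum_mono) (auto simp: X_def)
  also have "\<dots> = (real (card V) - card X) * ((real k - 1) * T + t) + card X * ((real k - 1) * T - T / 8)"
    using XV finite_V by (simp add: card_Diff_subset fX of_nat_diff card_mono)
  finally have "card X * (real T / 8 + t) \<le> card V * (t + k * d * T)"
    by (simp add: algebra_simps)
  moreover have "card X * (real T / 8) \<le> card X * (real T / 8 + t)"
    by (intro mult_left_mono) auto
  moreover have "card V * (t + k * d * T) \<le> card V * (d * T + k * d * T)"
    using T(2) by (intro mult_left_mono) auto
  ultimately have "card X * (real T / 8) \<le> card V * (d * T + k * d * T)"
    by linarith
  then have "T * real (card X) \<le> T * (8 * (real k + 1) * d * card V)"
    by (simp add: algebra_simps)
  then have cX: "real (card X) \<le> 8 * (real k + 1) * d * card V"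
    using T(1) by (simp add: mult_le_cancel_left)
  \<comment> \<open>The slack \<open>T / 8\<close> in \<open>X\<close> suffices: two such vertices
    share at least \<open>T - T / 4 - 2 * t\<close> neighbours in \<open>D j\<close>, and this is at
    least \<open>t\<close> because \<open>4 * t + 8 \<le> T\<close>.\<close>
  have typical: "real T - T / 8 - t \<le> card (Collect (E v) \<inter> D j)"
    if "v \<in> V - X" "j < k" "j \<noteq> p v" for v j
  proof -
    have "card (Collect (E v) \<inter> A) + 2 * T \<le> k * T + t + card (Collect (E v) \<inter> D j)"
      unfolding A_def by (rule multipartite_trace_le_pair[OF D p(1)[of v] p(2) that(2,3)])
    then have "real (card (Collect (E v) \<inter> A) + 2 * T) \<le> real (k * T + t + card (Collect (E v) \<inter> D j))"
      by (rule of_nat_mono)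
    moreover have "(real k - 1) * T - T / 8 \<le> real (card (Collect (E v) \<inter> A))"
      using that by (auto simp: X_def not_less)
    ultimately show ?thesis by (simp add: algebra_simps)
  qed
  have "p x \<noteq> p y" if xy: "E x y" "x \<notin> X" "y \<notin> X" for x y
  proof
    assume eq: "p x = p y"
    \<comment> \<open>The class \<open>p x\<close> is to contain the extra edge, so no adjacency to
      \<open>x\<close> or \<open>y\<close> is required there and only these two vertices are taken
      out. The other classes shrink to common neighbours.\<close>
    define C where "C j = (if j = p x then D j - {x, y} else Collect (E x) \<inter> Collect (E y) \<inter> D j)" for j
    have V: "x \<in> V - X" "y \<in> V - X" using xy E_V E_sym by blast+
    show False
    proof (rule crit_freeD[OF cf p(1)[of x] xy(1), of C])
      fix j assume j: "j < k"
      have DV: "D j \<subseteq> V" "card (D j) = T" "finite (D j)"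
        using D j multipartite_finite[OF D j] by (auto simp: multipartite_def)
      show "C j \<subseteq> V \<and> t \<le> card (C j)"
      proof (cases "j = p x")
        case True
        have "card (D j) - card {x, y} \<le> card (D j - {x, y})"
          by (rule diff_card_le_card_Diff) simp
        moreover have "card {x, y} \<le> 2" by (simp add: card_insert_if)
        ultimately have "t \<le> card (D j - {x, y})" using DV(2) T(1) by linarith
        then show ?thesis using True DV by (auto simp: C_def)
      next
        case False
        let ?P = "Collect (E x) \<inter> D j" and ?Q = "Collect (E y) \<inter> D j"
        have "card ?P + card ?Q = card (?P \<union> ?Q) + card (?P \<inter> ?Q)"
          by (rule card_Un_Int) auto
        moreover have "card (?P \<union> ?Q) \<le> T"
          using card_mono[OF DV(3), of "?P \<union> ?Q"] DV by auto
        ultimately have "real (card ?P) + card ?Q \<le> T + real (card (?P \<inter> ?Q))"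
          by linarith
        moreover have "real T - T / 8 - t \<le> card ?P" "real T - T / 8 - t \<le> card ?Q"
          using typical[OF V(1) j] typical[OF V(2) j] False eq by auto
        ultimately have "real t \<le> real (card (?P \<inter> ?Q))"
          using T(1) by linarith
        moreover have "?P \<inter> ?Q = C j" using False by (auto simp: C_def)
        ultimately show ?thesis using DV False by (auto simp: C_def)
      qed
    next
      fix i j u w assume "i < k" "j < k" "i \<noteq> j" "u \<in> C i" "w \<in> C j"
      then show "E u w" using D unfolding multipartite_def C_def by (auto split: if_splits)
    next
      fix j assume "j < k"
      show "x \<notin> C j \<and> y \<notin> C j" using E_irrefl by (auto simp: C_def)
    next
      fix j w assume "j < k" "j \<noteq> p x" "w \<in> C j"
      then show "E x w \<and> E y w" by (auto simp: C_def)
    qed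
  qed
  then show thesis by (rule that[OF XV cX p(1)])
qed

end

section \<open>Edge density and stability\<close>

text \<open>The minimum degree would force \<open>k\<close> classes of size \<open>T\<close>. On
  average a vertex would see at least \<open>k * T * (1 - \<theta>)\<close> of their vertices, but
  by \<open>crit_free_trace\<close> none sees more than \<open>(k - 1) * T + t\<close>. This fails
  once \<open>T * (1 - k * \<theta>) > t\<close>.\<close>

lemma crit_free_min_degree_bound:
  fixes \<theta> :: real
  assumes k: "k \<ge> 1" and \<theta>: "k * \<theta> < 1"
  shows "\<exists>n0. \<forall>(V :: 'b set) E. fgraph V E \<longrightarrow> crit_free V E k t \<longrightarrow> n0 \<le> card V \<longrightarrow>
           \<not> (\<forall>v\<in>V. (1 - \<theta>) * card V \<le> real (card (Collect (E v))))"
proof -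
  have i: "real i * \<theta> < 1" if "i < k" for i
  proof (cases "\<theta> \<le> 0")
    case True
    then have "real i * \<theta> \<le> 0" by (simp add: mult_nonneg_nonpos)
    then show ?thesis by simp
  next
    case False
    then have "real i * \<theta> \<le> real k * \<theta>" using that by (intro mult_right_mono) auto
    then show ?thesis using \<theta> by simp
  qed
  obtain T :: nat where "t / (1 - k * \<theta>) < T"
    using reals_Archimedean2 by blast
  then have T: "real t < T * (1 - k * \<theta>)"
    using \<theta> by (simp add: field_simps)
  obtain n0 where n0: "\<forall>(V :: 'b set) E. fgraph V E \<longrightarrow> n0 \<le> card V \<longrightarrow>
           (\<forall>v\<in>V. (1 - \<theta>) * card V \<le> real (card (Collect (E v)))) \<longrightarrow>
           (\<exists>D. multipartite V E k T D)"
    using multipartite_exists[OF i] by metis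
  show ?thesis
  \<comment> \<open>The additional 1 makes \<open>V\<close> nonempty, so that \<open>card V\<close>
    can be cancelled at the end.\<close>
  proof (intro exI[of _ "n0 + 1"] allI impI notI)
    fix V :: "'b set" and E
    assume G: "fgraph V E" and cf: "crit_free V E k t" and n: "n0 + 1 \<le> card V"
      and deg: "\<forall>v\<in>V. (1 - \<theta>) * card V \<le> real (card (Collect (E v)))"
    interpret fgraph V E by fact
    obtain D where D: "multipartite V E k T D"
      using n0 G n deg by (meson add_leD1)
    have "real k * T * ((1 - \<theta>) * card V) \<le> (\<Sum>v\<in>V. real (card (Collect (E v) \<inter> (\<Union>i<k. D i))))"
      by (rule multipartite_degree_sum[OF D]) (use deg in auto)
    also have "\<dots> \<le> (\<Sum>v\<in>V. (real k - 1) * T + t)"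
    proof (rule sum_mono)
      fix v
      obtain i where i: "i < k" "card (Collect (E v) \<inter> D i) \<le> t"
        using crit_free_trace[OF cf k D] by blast
      have "real (card (Collect (E v) \<inter> (\<Union>i<k. D i)) + T) \<le> real (k * T + t)"
        by (rule of_nat_mono[OF multipartite_trace_le[OF D i]])
      then show "real (card (Collect (E v) \<inter> (\<Union>i<k. D i))) \<le> (real k - 1) * T + t"
        by (simp add: algebra_simps)
    qed
    finally have "card V * (T * (1 - k * \<theta>)) \<le> card V * real t"
      by (simp add: algebra_simps)
    then have "T * (1 - k * \<theta>) \<le> t"
      using n by (simp add: mult_le_cancel_left)
    then show False using T by simp
  qed
qed

text \<open>Too many arcs leave the potential of \<open>min_degree_subset\<close> so large that the
  maximiser \<open>S\<close> has at least \<open>n1\<close> vertices. Its minimum degree then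
  contradicts \<open>crit_free_min_degree_bound\<close>.\<close>

lemma crit_free_arcs_bound:
  fixes c :: real
  assumes k: "k \<ge> 1" and c: "c > 0"
  shows "\<exists>n0. \<forall>(V :: 'b set) E. fgraph V E \<longrightarrow> crit_free V E k t \<longrightarrow> n0 \<le> card V \<longrightarrow>
           real (arcs E V) \<le> (1 - 1 / k + c) * real (card V) ^ 2"
proof -
  define \<beta> where "\<beta> = 1 - 1 / k + c / 2"
  have \<beta>0: "\<beta> \<ge> 0" using k c by (simp add: \<beta>_def)
  have "k * (1 - \<beta>) < 1" using k c by (simp add: \<beta>_def field_simps)
  from crit_free_min_degree_bound[OF k this, of t]
  obtain n1 where n1: "\<And>(V :: 'b set) E. fgraph V E \<Longrightarrow> crit_free V E k t \<Longrightarrow> n1 \<le> card V \<Longrightarrow>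
           \<not> (\<forall>v\<in>V. (1 - (1 - \<beta>)) * card V \<le> real (card (Collect (E v))))"
    by blast
  \<comment> \<open>The first term absorbs the linear error \<open>\<beta> * n\<close> into
    \<open>c / 4 * n^2\<close>; the second makes the remaining \<open>c / 4 * n^2\<close> exceed
    \<open>n1^2\<close>.\<close>
  obtain n0 :: nat where n0: "max (4 * \<beta> / c) (4 * real n1 ^ 2 / c) + 1 \<le> n0"
    using real_arch_simple by blast
  show ?thesis
  proof (intro exI[of _ n0] allI impI, rule ccontr)
    fix V :: "'b set" and E
    assume G: "fgraph V E" and cf: "crit_free V E k t" and n: "n0 \<le> card V"
      and contr: "\<not> real (arcs E V) \<le> (1 - 1 / k + c) * real (card V) ^ 2"
    interpret fgraph V E by fact
    obtain S where S: "S \<subseteq> V"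
      "arcs E V - \<beta> * card V * (real (card V) + 1) \<le> arcs E S - \<beta> * card S * (real (card S) + 1)"
      "\<And>v. v \<in> S \<Longrightarrow> \<beta> * card S \<le> card (Collect (E v) \<inter> S)"
      using min_degree_subset by blast
    have fS: "finite S" using S finite_V finite_subset by blast
    define n where "n = real (card V)"
    have nn: "4 * \<beta> / c \<le> n" "4 * real n1 ^ 2 / c < n" "1 \<le> n"
    proof -
      have "real n0 \<le> n" using \<open>n0 \<le> card V\<close> by (simp add: n_def)
      moreover have "0 \<le> 4 * \<beta> / c" using \<beta>0 c by simp
      ultimately show "4 * \<beta> / c \<le> n" "4 * real n1 ^ 2 / c < n" "1 \<le> n" using n0 by linarith+
    qed
    have "(1 - 1 / k + c) * n ^ 2 - \<beta> * n * (n + 1) \<le> arcs E S - \<beta> * card S * (real (card S) + 1)"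
      using contr S(2) by (simp add: n_def)
    also have "\<dots> \<le> arcs E S" using \<beta>0 by simp
    also have "\<dots> \<le> real (card S) ^ 2" by (rule arcs_le[OF fS])
    finally have "(c / 2) * n ^ 2 - \<beta> * n \<le> real (card S) ^ 2"
      by (simp add: \<beta>_def algebra_simps power2_eq_square add_divide_distrib)
    moreover have "\<beta> * n \<le> (c / 4) * n * n"
      using nn(1,3) c by (intro mult_right_mono) (auto simp: field_simps)
    ultimately have s: "(c / 4) * n * n \<le> real (card S) ^ 2"
      by (simp add: power2_eq_square)
    have "real n1 ^ 2 < (c / 4) * n" using nn(2) c by (simp add: field_simps)
    also have "\<dots> \<le> (c / 4) * n * n" using nn(3) c by simp
    finally have "real n1 ^ 2 < real (card S) ^ 2" using s by linarith
    then have "n1 \<le> card S" by (metis less_imp_le of_nat_0_le_iff of_nat_le_iff power2_le_imp_le)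
    let ?E = "\<lambda>x y. E x y \<and> x \<in> S \<and> y \<in> S"
    have "\<forall>v\<in>S. (1 - (1 - \<beta>)) * card S \<le> real (card (Collect (?E v)))"
    proof
      fix v assume v: "v \<in> S"
      then have "Collect (?E v) = Collect (E v) \<inter> S" by auto
      then show "(1 - (1 - \<beta>)) * card S \<le> real (card (Collect (?E v)))"
        using S(3)[OF v] by simp
    qed
    then show False
      using n1[OF fgraph_induced[OF S(1)] crit_free_induced[OF cf S(1)] \<open>n1 \<le> card S\<close>] by blast
  qed
qed

text \<open>The function \<open>p\<close> encodes a partition, the class of \<open>v\<close> being
  \<open>p v\<close>. As in \<open>arcs\<close>, every inner edge is counted twice.\<close>

definition inner_arcs :: "('b \<Rightarrow> 'b \<Rightarrow> bool) \<Rightarrow> ('b \<Rightarrow> nat) \<Rightarrow> ('b \<times> 'b) set" where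
  "inner_arcs E p = {(x, y). E x y \<and> p x = p y}"

text \<open>For a graph close to the extremal density, the maximiser \<open>S\<close> of the
  potential with \<beta> slightly below \<open>1 - 1 / k\<close> contains almost all vertices,
  because \<open>S\<close> itself obeys the upper bound on arcs. The structure lemma applies inside
  \<open>S\<close>, and each inner edge meets its exceptional set or \<open>V - S\<close>.\<close>

lemma crit_free_stability:
  fixes \<epsilon> :: real
  assumes k: "k \<ge> 2" and \<epsilon>: "\<epsilon> > 0"
  shows "\<exists>\<delta>>0. \<exists>n0. \<forall>(V :: 'b set) E. fgraph V E \<longrightarrow> crit_free V E k t \<longrightarrow> n0 \<le> card V \<longrightarrow>
           (1 - 1 / k - \<delta>) * real (card V) ^ 2 \<le> arcs E V \<longrightarrow>
           (\<exists>p. (\<forall>v. p v < k) \<and> card (inner_arcs E p) \<le> \<epsilon> * real (card V) ^ 2)"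
proof -
  \<comment> \<open>The first term serves the final count, where 22 is twice \<open>8 + 3\<close>: 8
    from the exceptional set, 3 from \<open>V - S\<close>. The second keeps
    \<open>i * (1 / k + d)\<close> below 1 for \<open>i < k\<close>. The stability parameter will be
    \<open>d^2\<close>, an order smaller than the degree slack \<open>d\<close>.\<close>
  define d where "d = min (\<epsilon> / (22 * (real k + 1))) (1 / (4 * real k ^ 2))"
  have d0: "d > 0" using \<epsilon> k by (simp add: d_def)
  have "22 * (real k + 1) * d \<le> 22 * (real k + 1) * (\<epsilon> / (22 * (real k + 1)))"
    by (intro mult_left_mono) (auto simp: d_def)
  then have d1: "22 * (real k + 1) * d \<le> \<epsilon>"
    by (simp add: add.commute)
  have "4 * real k ^ 2 * d \<le> 4 * real k ^ 2 * (1 / (4 * real k ^ 2))"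
    by (intro mult_left_mono) (auto simp: d_def)
  then have d2: "4 * real k ^ 2 * d \<le> 1"
    using k by simp
  have "1 * d \<le> real k ^ 2 * d"
    using k d0 by (intro mult_right_mono) auto
  then have d3: "d \<le> 1 / 4" using d2 by simp
  have i: "real i * (1 / k + d) < 1" if "i < k" for i
  proof -
    have "real i * (1 / k + d) \<le> (real k - 1) * (1 / k + d)"
      using that d0 by (intro mult_right_mono) (auto simp: add_nonneg_nonneg)
    also have "\<dots> < 1"
    proof -
      have "real k * ((real k - 1) * (1 / k + d)) = (real k - 1) + (real k ^ 2 * d - k * d)"
        using k by (simp add: field_simps power2_eq_square)
      also have "\<dots> < real k * 1"
      proof -
        have "0 < k * d" using k d0 by simp
        then show ?thesis using d2 by linarith
      qed
      finally show ?thesis using k by (simp add: mult_less_cancel_left)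
    qed
    finally show ?thesis .
  qed
  obtain T :: nat where "max (t / d) (4 * t + 8) \<le> T"
    using real_arch_simple by blast
  then have T: "4 * t + 8 \<le> T" "real t \<le> d * T"
    using d0 by (auto simp: field_simps)
  obtain n1 where n1: "\<And>(V :: 'b set) E. fgraph V E \<Longrightarrow> n1 \<le> card V \<Longrightarrow>
           (\<forall>v\<in>V. (1 - (1 / k + d)) * card V \<le> real (card (Collect (E v)))) \<Longrightarrow>
           (\<exists>D. multipartite V E k T D)"
    using multipartite_exists[OF i, of k T] by metis
  obtain n2 where n2: "\<And>(V :: 'b set) E. fgraph V E \<Longrightarrow> crit_free V E k t \<Longrightarrow> n2 \<le> card V \<Longrightarrow>
           real (arcs E V) \<le> (1 - 1 / k + d ^ 2) * real (card V) ^ 2"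
    using crit_free_arcs_bound[of k "d ^ 2" t] k d0 by force
  define N where "N = max n1 n2"
  \<comment> \<open>The first term absorbs \<open>\<beta> * n\<close> into \<open>d^2 * n^2\<close>;
    the second guarantees that \<open>S\<close> has at least \<open>N\<close> vertices.\<close>
  obtain n0 :: nat where n0: "max (1 / d ^ 2) (2 * real N ^ 2 / d) + 1 \<le> n0"
    using real_arch_simple by blast
  have "\<exists>p. (\<forall>v. p v < k) \<and> card (inner_arcs E p) \<le> \<epsilon> * real (card V) ^ 2"
    if G: "fgraph V E" and cf: "crit_free V E k t" and n: "n0 \<le> card V"
      and lower: "(1 - 1 / k - d ^ 2) * real (card V) ^ 2 \<le> arcs E V" for V :: "'b set" and E
  proof -
    interpret fgraph V E by fact
    define \<beta> where "\<beta> = 1 - (1 / k + d)"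
    have "1 / real k \<le> 1 / 2" using k by simp
    moreover have "0 \<le> 1 / real k" by simp
    ultimately have \<beta>: "0 \<le> \<beta>" "\<beta> \<le> 1" using d0 d3 unfolding \<beta>_def by linarith+
    obtain S where S: "S \<subseteq> V"
      "arcs E V - \<beta> * card V * (real (card V) + 1) \<le> arcs E S - \<beta> * card S * (real (card S) + 1)"
      "\<And>v. v \<in> S \<Longrightarrow> \<beta> * card S \<le> card (Collect (E v) \<inter> S)"
      using min_degree_subset by blast
    have fS: "finite S" using S finite_V finite_subset by blast
    define n where "n = real (card V)"
    define s where "s = real (card S)"
    have nn: "1 / d ^ 2 \<le> n" "2 * real N ^ 2 / d < n" "1 \<le> n"
    proof -
      have "real n0 \<le> n" using \<open>n0 \<le> card V\<close> by (simp add: n_def)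
      moreover have "0 \<le> 1 / d ^ 2" by simp
      ultimately show "1 / d ^ 2 \<le> n" "2 * real N ^ 2 / d < n" "1 \<le> n" using n0 by linarith+
    qed
    have s0: "0 \<le> s" "s \<le> n" using S(1) finite_V by (auto simp: s_def n_def card_mono)
    let ?E = "\<lambda>x y. E x y \<and> x \<in> S \<and> y \<in> S"
    have GS: "fgraph S ?E" by (rule fgraph_induced[OF S(1)])
    have cfS: "crit_free S ?E k t" by (rule crit_free_induced[OF cf S(1)])
    have "{(x, y). x \<in> S \<and> y \<in> S \<and> ?E x y} = {(x, y). x \<in> S \<and> y \<in> S \<and> E x y}"
      by auto
    then have arcsS: "arcs ?E S = arcs E S" by (simp add: arcs_def)
    have "\<beta> * n \<le> d ^ 2 * n * n"
    proof (rule mult_right_mono)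
      have "1 \<le> d ^ 2 * n" using nn(1) d0 by (simp add: field_simps)
      then show "\<beta> \<le> d ^ 2 * n" using \<beta> by simp
    qed (use nn in simp)
    moreover have "(1 - 1 / k - d ^ 2) * n ^ 2 - \<beta> * n * (n + 1) = (d - d ^ 2) * n ^ 2 - \<beta> * n"
      by (simp add: \<beta>_def algebra_simps power2_eq_square add_divide_distrib)
    ultimately have low: "(d - 2 * d ^ 2) * n ^ 2 \<le> arcs E S - \<beta> * s * (s + 1)"
      using lower S(2) unfolding n_def[symmetric] s_def[symmetric]
      by (simp add: algebra_simps power2_eq_square)
    moreover have "\<beta> * s * (s + 1) = \<beta> * s ^ 2 + \<beta> * s"
      by (simp add: algebra_simps power2_eq_square)
    moreover have "0 \<le> \<beta> * s" using \<beta> s0 by simp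
    ultimately have low': "(d - 2 * d ^ 2) * n ^ 2 \<le> arcs E S - \<beta> * s ^ 2" by linarith
    have "N \<le> card S"
    proof -
      have "d * d \<le> d * (1 / 4)" using d3 d0 by (intro mult_left_mono) auto
      then have "d / 2 \<le> d - 2 * d ^ 2" by (simp add: power2_eq_square)
      then have "(d / 2) * n ^ 2 \<le> (d - 2 * d ^ 2) * n ^ 2"
        by (rule mult_right_mono) simp
      also have "\<dots> \<le> arcs E S - \<beta> * s ^ 2" by (rule low')
      also have "\<dots> \<le> arcs E S" using \<beta> by simp
      also have "\<dots> \<le> s ^ 2" unfolding s_def by (rule arcs_le[OF fS])
      finally have "(d / 2) * n ^ 2 \<le> s ^ 2" .
      moreover have "real N ^ 2 < (d / 2) * n" using nn(2) d0 by (simp add: field_simps)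
      moreover have "(d / 2) * n \<le> (d / 2) * n ^ 2"
        using nn(3) d0 by (intro mult_left_mono) (auto simp: power2_eq_square)
      ultimately have "real N ^ 2 \<le> real (card S) ^ 2" unfolding s_def by linarith
      then show ?thesis by (metis of_nat_0_le_iff of_nat_le_iff power2_le_imp_le)
    qed
    then have "n1 \<le> card S" "n2 \<le> card S" by (auto simp: N_def)
    have degS: "(1 - (1 / k + d)) * card S \<le> real (card (Collect (?E v)))" if v: "v \<in> S" for v
    proof -
      have "Collect (?E v) = Collect (E v) \<inter> S" using v by auto
      then show ?thesis using S(3)[OF v] by (simp add: \<beta>_def)
    qed
    have "arcs E S \<le> (1 - 1 / k + d ^ 2) * s ^ 2"
      using n2[OF GS cfS \<open>n2 \<le> card S\<close>] by (simp add: arcsS s_def)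
    then have "(d - 2 * d ^ 2) * n ^ 2 \<le> (1 - 1 / k + d ^ 2) * s ^ 2 - \<beta> * s ^ 2"
      using low' by linarith
    also have "\<dots> = (d + d ^ 2) * s ^ 2" by (simp add: \<beta>_def algebra_simps)
    finally have "d * ((1 - 2 * d) * n ^ 2) \<le> d * ((1 + d) * s ^ 2)"
      by (simp add: algebra_simps power2_eq_square)
    then have "(1 - 2 * d) * n ^ 2 \<le> (1 + d) * s ^ 2" using d0 by simp
    \<comment> \<open>Indeed \<open>(1 + d) * (1 - 3 * d) = 1 - 2 * d - 3 * d^2\<close>. Cancelling
      \<open>1 + d\<close> and using \<open>s \<le> n\<close> yields a bound linear in
      \<open>s\<close>.\<close>
    moreover have "(1 + d) * (1 - 3 * d) * n ^ 2 \<le> (1 - 2 * d) * n ^ 2"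
      by (intro mult_right_mono) (auto simp: algebra_simps)
    ultimately have "(1 + d) * ((1 - 3 * d) * n ^ 2) \<le> (1 + d) * s ^ 2" by (simp add: mult.assoc)
    then have "(1 - 3 * d) * n ^ 2 \<le> s ^ 2" using d0 by (simp add: mult_le_cancel_left)
    also have "\<dots> \<le> s * n" using s0 by (simp add: power2_eq_square mult_left_mono)
    finally have "n * ((1 - 3 * d) * n) \<le> n * s" by (simp add: power2_eq_square algebra_simps)
    then have sn: "(1 - 3 * d) * n \<le> s" using nn(3) by (simp add: mult_le_cancel_left)
    obtain D where D: "multipartite S ?E k T D"
      using n1[OF GS \<open>n1 \<le> card S\<close>] degS by blast
    obtain X p where X: "X \<subseteq> S" "real (card X) \<le> 8 * (real k + 1) * d * card S" "\<And>v. p v < k"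
      "\<And>x y. ?E x y \<Longrightarrow> x \<notin> X \<Longrightarrow> y \<notin> X \<Longrightarrow> p x \<noteq> p y"
      by (rule fgraph.crit_free_min_degree_structure[OF GS cfS k D degS T]) blast+
    \<comment> \<open>All inner arcs have an endpoint in \<open>Z\<close>, so there are at most
      \<open>2 * card Z * card V\<close> of them.\<close>
    define Z where "Z = X \<union> (V - S)"
    have fZ: "finite Z" using X(1) S(1) finite_V by (auto simp: Z_def intro: finite_subset)
    have "card Z \<le> card X + card (V - S)" unfolding Z_def by (rule card_Un_le)
    moreover have "real (card (V - S)) = n - s"
      using S(1) fS finite_V by (simp add: card_Diff_subset n_def s_def of_nat_diff card_mono)
    moreover have "8 * (real k + 1) * d * s \<le> 8 * (real k + 1) * d * n"
      using s0 d0 by (intro mult_left_mono) auto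
    moreover have "3 * d * n \<le> 3 * (real k + 1) * d * n"
      using d0 nn(3) by (intro mult_right_mono) auto
    ultimately have cZ: "card Z \<le> 11 * (real k + 1) * d * n"
      using X(2) sn unfolding s_def[symmetric] by (simp add: algebra_simps)
    have "inner_arcs E p \<subseteq> Z \<times> V \<union> V \<times> Z"
    proof
      fix e assume "e \<in> inner_arcs E p"
      then obtain x y where e: "e = (x, y)" "E x y" "p x = p y" by (auto simp: inner_arcs_def)
      have V: "x \<in> V" "y \<in> V" using e(2) E_V E_sym by blast+
      have "x \<in> Z \<or> y \<in> Z"
        using X(4)[of x y] e V by (auto simp: Z_def)
      then show "e \<in> Z \<times> V \<union> V \<times> Z" using e V by blast
    qed
    then have "card (inner_arcs E p) \<le> card (Z \<times> V \<union> V \<times> Z)"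
      using fZ finite_V by (intro card_mono) auto
    also have "\<dots> \<le> card (Z \<times> V) + card (V \<times> Z)" by (rule card_Un_le)
    finally have "card (inner_arcs E p) \<le> 2 * card Z * card V"
      by (simp add: card_cartesian_product algebra_simps)
    then have "real (card (inner_arcs E p)) \<le> real (2 * card Z * card V)"
      by (rule of_nat_mono)
    also have "\<dots> = 2 * real (card Z) * n" by (simp add: n_def)
    also have "\<dots> \<le> 2 * (11 * (real k + 1) * d * n) * n"
      using cZ nn(3) by (intro mult_right_mono mult_left_mono) auto
    also have "\<dots> = (22 * (real k + 1) * d) * n ^ 2" by (simp add: power2_eq_square)
    also have "\<dots> \<le> \<epsilon> * n ^ 2" using d1 by (intro mult_right_mono) auto
    finally show ?thesis using X(3) unfolding n_def by blast
  qed
  then show ?thesis using d0 by (intro exI[of _ "d ^ 2"] conjI exI[of _ n0]) auto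
qed

text \<open>Excludes \<open>M\<^sub>k(t, t, 1)\<close>, where \<open>D i\<close> plays the role of \<open>V\<^sub>i\<close> and \<open>z\<close> is the vertex of \<open>U\<close>.\<close>

definition myc_free :: "'b set \<Rightarrow> ('b \<Rightarrow> 'b \<Rightarrow> bool) \<Rightarrow> nat \<Rightarrow> nat \<Rightarrow> bool" where
  "myc_free V E k t \<longleftrightarrow>
     (\<nexists>z D W. multipartite V E k t D \<and>
        (\<forall>i<k. W i \<subseteq> V \<and> card (W i) = t \<and> z \<notin> D i \<and> D i \<inter> W i = {} \<and> (\<forall>w\<in>W i. E z w)) \<and>
        (\<forall>i<k. \<forall>j<k. i \<noteq> j \<longrightarrow> W i \<inter> W j = {} \<and> (\<forall>x\<in>D i. \<forall>y\<in>W j. E x y)))"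

section \<open>Partitions with the fewest inner edges, and greedy embedding\<close>

context fgraph
begin

definition missing :: "('b \<Rightarrow> nat) \<Rightarrow> 'b \<Rightarrow> 'b set" where
  "missing p v = {w \<in> V. p w \<noteq> p v \<and> \<not> E v w}"

lemma finite_inner_arcs: "finite (inner_arcs E p)"
  by (rule finite_subset[of _ "V \<times> V"])
     (use finite_V in \<open>auto simp: inner_arcs_def dest: E_V E_V[OF E_sym]\<close>)

text \<open>Isolates the contribution of \<open>v\<close>: moving only \<open>v\<close> to another
  class leaves the first summand unchanged.\<close>

lemma inner_arcs_split:
  shows "card (inner_arcs E p) = card {(x, y) \<in> inner_arcs E p. x \<noteq> v \<and> y \<noteq> v}
    + 2 * card {w. E v w \<and> p w = p v}"
proof -
  let ?N = "{w. E v w \<and> p w = p v}" and ?R = "{(x, y) \<in> inner_arcs E p. x \<noteq> v \<and> y \<noteq> v}"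
  have fN: "finite ?N" by (rule finite_subset[of _ "Collect (E v)"]) auto
  have fR: "finite ?R" by (rule finite_subset[OF _ finite_inner_arcs]) auto
  have *: "inner_arcs E p = ?R \<union> ({v} \<times> ?N \<union> ?N \<times> {v})"
    using E_commute by (auto simp: inner_arcs_def)
  have "card ({v} \<times> ?N \<union> ?N \<times> {v}) = card ({v} \<times> ?N) + card (?N \<times> {v})"
    using fN E_irrefl by (intro card_Un_disjoint) auto
  then have "card (?R \<union> ({v} \<times> ?N \<union> ?N \<times> {v})) = card ?R + 2 * card ?N"
    using fN fR by (subst card_Un_disjoint) auto
  moreover have "card (inner_arcs E p) = card (?R \<union> ({v} \<times> ?N \<union> ?N \<times> {v}))"
    using * by (rule arg_cong)
  ultimately show ?thesis
    by (rule trans[rotated])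
qed

lemma min_inner_arcs:
  assumes "k \<ge> 1"
  obtains p where "\<forall>v. p v < k" "\<forall>q. (\<forall>v. q v < k) \<longrightarrow> card (inner_arcs E p) \<le> card (inner_arcs E q)"
    "\<forall>v. \<forall>i<k. card {w. E v w \<and> p w = p v} \<le> card {w. E v w \<and> p w = i}"
proof -
  have "\<exists>p :: 'b \<Rightarrow> nat. (\<forall>v. p v < k)"
    using assms by (intro exI[of _ "\<lambda>_. 0"]) auto
  then have "\<exists>p. (\<forall>v. p v < k) \<and>
      (\<forall>q. (\<forall>v. q v < k) \<longrightarrow> card (inner_arcs E p) \<le> card (inner_arcs E q))"
    using ex_has_least_nat[of "\<lambda>p. \<forall>v. p v < k" _ "\<lambda>p. card (inner_arcs E p)"] by blast
  then obtain p where p: "\<And>v. p v < k"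
    "\<And>q. (\<And>v. q v < k) \<Longrightarrow> card (inner_arcs E p) \<le> card (inner_arcs E q)"
    by blast
  show thesis
  proof (rule that; intro allI impI)
    fix v i assume i: "i < k"
    \<comment> \<open>Moving \<open>v\<close> to class \<open>i\<close> cannot reduce the number of
      inner arcs, so \<open>v\<close> has at least as many neighbours there as in its own
      class.\<close>
    let ?q = "p(v := i)"
    have "{(x, y) \<in> inner_arcs E ?q. x \<noteq> v \<and> y \<noteq> v} = {(x, y) \<in> inner_arcs E p. x \<noteq> v \<and> y \<noteq> v}"
      by (auto simp: inner_arcs_def)
    moreover have "{w. E v w \<and> ?q w = ?q v} = {w. E v w \<and> p w = i}"
      using E_irrefl by auto
    moreover have "card (inner_arcs E p) \<le> card (inner_arcs E ?q)"
      using i p(1) by (intro p(2)) auto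
    ultimately show "card {w. E v w \<and> p w = p v} \<le> card {w. E v w \<and> p w = i}"
      using inner_arcs_split[of p v] inner_arcs_split[of ?q v] by simp
  qed (use p in auto)
qed

text \<open>The classes are chosen one after another. The next one avoids \<open>B\<close>,
  \<open>Z\<close> and everything missed by \<open>S\<close> or by earlier classes; these are at
  most \<open>card S + k * t\<close> vertices outside \<open>B\<close>, each missing at most
  \<open>g\<close>, so \<open>size\<close> leaves \<open>t\<close> candidates.\<close>

lemma greedy_multipartite:
  fixes g :: real
  assumes S: "S \<subseteq> V - B" and B: "B \<subseteq> V" "\<And>v. v \<in> V - B \<Longrightarrow> card (missing p v) \<le> g"
    and Z: "finite Z" and g: "0 \<le> g"
    and size: "\<And>i. i < k \<Longrightarrow> (card S + k * t) * g + card B + card Z + t \<le> card {v \<in> V. p v = i}"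
    and "r \<le> k"
  shows "\<exists>D. (\<forall>i<r. D i \<subseteq> {v \<in> V. p v = i} - B - Z) \<and> multipartite V E r t D \<and>
             (\<forall>i<r. \<forall>x\<in>D i. \<forall>s\<in>S. p s \<noteq> i \<longrightarrow> E x s)"
  using \<open>r \<le> k\<close>
proof (induction r)
  case 0
  then show ?case by (auto simp: multipartite_def)
next
  case (Suc r)
  then obtain D where "\<forall>i<r. D i \<subseteq> {v \<in> V. p v = i} - B - Z" "multipartite V E r t D"
    "\<forall>i<r. \<forall>x\<in>D i. \<forall>s\<in>S. p s \<noteq> i \<longrightarrow> E x s"
    by auto
  note D = this[rule_format]
  define Q where "Q = S \<union> (\<Union>i<r. D i)"
  define U where "U = (\<Union>q\<in>Q. missing p q)"
  have QV: "Q \<subseteq> V - B" using S D(1) by (auto simp: Q_def)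
  have fQ: "finite Q" using QV finite_V finite_subset by blast
  have fU: "finite U"
    unfolding U_def missing_def using finite_V fQ by auto
  have fB: "finite B" using B(1) finite_V finite_subset by blast
  have "card Q \<le> card S + card (\<Union>i<r. D i)" unfolding Q_def by (rule card_Un_le)
  also have "card (\<Union>i<r. D i) \<le> (\<Sum>i<r. card (D i))" by (rule card_UN_le) simp
  also have "\<dots> = r * t" using D(2) by (simp add: multipartite_def)
  also have "\<dots> \<le> k * t" using Suc.prems by simp
  finally have cQ: "card Q \<le> card S + k * t" by simp
  have "card U \<le> (\<Sum>q\<in>Q. card (missing p q))" unfolding U_def by (rule card_UN_le[OF fQ])
  then have "real (card U) \<le> (\<Sum>q\<in>Q. real (card (missing p q)))"
    by (metis of_nat_mono of_nat_sum)
  also have "\<dots> \<le> (\<Sum>q\<in>Q. g)" using B(2) QV by (intro sum_mono) auto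
  also have "\<dots> = card Q * g" by simp
  also have "\<dots> \<le> (card S + k * t) * g"
    using g by (intro mult_right_mono of_nat_mono cQ)
  finally have cU: "real (card U) \<le> (card S + k * t) * g" .
  define C where "C = {v \<in> V. p v = r} - (B \<union> Z \<union> U)"
  have "card {v \<in> V. p v = r} - card (B \<union> Z \<union> U) \<le> card C"
    unfolding C_def by (rule diff_card_le_card_Diff) (use fB Z fU in auto)
  moreover have "card (B \<union> Z \<union> U) \<le> card B + card Z + card U"
    using card_Un_le[of "B \<union> Z" U] card_Un_le[of B Z] by linarith
  ultimately have "card {v \<in> V. p v = r} \<le> card B + card Z + card U + card C"
    by linarith
  then have "real (card {v \<in> V. p v = r}) \<le> real (card B + card Z + card U + card C)"
    by (rule of_nat_mono)
  moreover have "(card S + k * t) * g + card B + card Z + t \<le> card {v \<in> V. p v = r}"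
    using Suc.prems by (intro size) simp
  ultimately have "t \<le> card C" using cU by simp
  then obtain W where W: "W \<subseteq> C" "card W = t"
    by (meson obtain_subset_with_card_n)
  have WQ: "E w q" if "w \<in> W" "q \<in> Q" "p q \<noteq> r" for w q
  proof -
    have "w \<in> V" "p w = r" "w \<notin> missing p q"
      using that W by (auto simp: C_def U_def)
    then have "E q w" using that(3) by (auto simp: missing_def)
    then show ?thesis by (rule E_sym)
  qed
  define D' where "D' = D(r := W)"
  have D'_simps: "D' r = W" "\<And>i. i < r \<Longrightarrow> D' i = D i" by (auto simp: D'_def)
  have WD: "E w x" if "w \<in> W" "x \<in> D i" "i < r" for w x i
    using that D(1)[of i] by (intro WQ) (auto simp: Q_def)
  show ?case
  proof (intro exI[of _ D'] conjI allI impI ballI)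
    fix i assume "i < Suc r"
    then show "D' i \<subseteq> {v \<in> V. p v = i} - B - Z"
      using D(1)[of i] W D'_simps by (cases "i = r") (auto simp: C_def)
  next
    fix i x s assume "i < Suc r" "x \<in> D' i" "s \<in> S" "p s \<noteq> i"
    then show "E x s"
      using D(3)[of i x s] WQ[of x s] D'_simps by (cases "i = r") (auto simp: Q_def)
  next
    show "multipartite V E (Suc r) t D'"
      unfolding multipartite_def
    proof (intro conjI allI impI ballI)
      fix i assume i: "i < Suc r"
      show "D' i \<subseteq> V" "card (D' i) = t"
        using i D(2) W D'_simps by (cases "i = r"; auto simp: C_def multipartite_def)+
    next
      fix i j x y assume "i < Suc r" "j < Suc r" "i \<noteq> j" "x \<in> D' i" "y \<in> D' j"
      then show "E x y"
        using WD D(2) D'_simps E_sym unfolding multipartite_def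
        by (cases "i = r"; cases "j = r") (auto simp: less_Suc_eq)
    qed
  qed
qed

lemma card_classes:
  fixes p :: "'b \<Rightarrow> nat"
  assumes "\<And>v. p v < k"
  shows "(\<Sum>i<k. card {v \<in> V. p v = i}) = card V"
    and "(\<Sum>i<k. card {v \<in> V. p v = i} ^ 2) + card {(x, y) \<in> V \<times> V. p x \<noteq> p y} = card V ^ 2"
proof -
  have "card (\<Union>i<k. {v \<in> V. p v = i}) = (\<Sum>i<k. card {v \<in> V. p v = i})"
    by (rule card_UN_disjoint) (use finite_V in auto)
  moreover have "(\<Union>i<k. {v \<in> V. p v = i}) = V" using assms by auto
  ultimately show "(\<Sum>i<k. card {v \<in> V. p v = i}) = card V" by simp
  let ?C = "\<lambda>i. {v \<in> V. p v = i} \<times> {v \<in> V. p v = i}"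
  have "card (\<Union>i<k. ?C i) = (\<Sum>i<k. card (?C i))"
    by (rule card_UN_disjoint) (use finite_V in auto)
  also have "\<dots> = (\<Sum>i<k. card {v \<in> V. p v = i} ^ 2)"
    by (simp add: card_cartesian_product power2_eq_square)
  finally have "(\<Sum>i<k. card {v \<in> V. p v = i} ^ 2) + card {(x, y) \<in> V \<times> V. p x \<noteq> p y}
      = card (\<Union>i<k. ?C i) + card {(x, y) \<in> V \<times> V. p x \<noteq> p y}" by simp
  also have "\<dots> = card ((\<Union>i<k. ?C i) \<union> {(x, y) \<in> V \<times> V. p x \<noteq> p y})"
  proof (rule card_Un_disjoint[symmetric])
    show "finite {(x, y) \<in> V \<times> V. p x \<noteq> p y}"
      by (rule finite_subset[of _ "V \<times> V"]) (use finite_V in auto)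
  qed (use finite_V in auto)
  also have "(\<Union>i<k. ?C i) \<union> {(x, y) \<in> V \<times> V. p x \<noteq> p y} = V \<times> V"
    using assms by auto
  finally show "(\<Sum>i<k. card {v \<in> V. p v = i} ^ 2) + card {(x, y) \<in> V \<times> V. p x \<noteq> p y} = card V ^ 2"
    by (simp add: card_cartesian_product power2_eq_square)
qed

text \<open>Both sides count adjacent crossing pairs, nonadjacent crossing pairs and inner arcs once
  each.\<close>

lemma card_cross:
  "card {(x, y) \<in> V \<times> V. p x \<noteq> p y} + card (inner_arcs E p) = arcs E V + (\<Sum>v\<in>V. card (missing p v))"
proof -
  let ?A = "{(x, y). E x y \<and> p x \<noteq> p y}" and ?M = "SIGMA v:V. missing p v"
  have fA: "finite ?A"
    by (rule finite_subset[of _ "V \<times> V"])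
       (use finite_V in \<open>auto dest: E_V E_V[OF E_sym]\<close>)
  have fM: "finite ?M" using finite_V by (intro finite_SigmaI) (auto simp: missing_def)
  have "{(x, y) \<in> V \<times> V. p x \<noteq> p y} = ?A \<union> ?M"
    by (auto simp: missing_def dest: E_V E_V[OF E_sym])
  also have "card \<dots> = card ?A + card ?M"
    by (rule card_Un_disjoint[OF fA fM]) (auto simp: missing_def)
  also have "card ?M = (\<Sum>v\<in>V. card (missing p v))"
    using finite_V by (simp add: missing_def)
  finally have 1: "card {(x, y) \<in> V \<times> V. p x \<noteq> p y} = card ?A + (\<Sum>v\<in>V. card (missing p v))" .
  have "{(x, y). x \<in> V \<and> y \<in> V \<and> E x y} = inner_arcs E p \<union> ?A"
    by (auto simp: inner_arcs_def dest: E_V E_V[OF E_sym])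
  moreover have "card (inner_arcs E p \<union> ?A) = card (inner_arcs E p) + card ?A"
    by (rule card_Un_disjoint[OF finite_inner_arcs fA]) (auto simp: inner_arcs_def)
  ultimately show ?thesis using 1 by (simp add: arcs_def)
qed

end

section \<open>The quantitative bound on the inner edges\<close>

lemma sum_square_deviation:
  fixes q :: "nat \<Rightarrow> real"
  assumes "k \<ge> 1"
  shows "(\<Sum>i<k. (q i - (\<Sum>i<k. q i) / k)\<^sup>2) = (\<Sum>i<k. (q i)\<^sup>2) - (\<Sum>i<k. q i)\<^sup>2 / k"
proof -
  define n where "n = (\<Sum>i<k. q i)"
  have "(\<Sum>i<k. (q i - n / k)\<^sup>2) = (\<Sum>i<k. (q i)\<^sup>2 - 2 * (n / k) * q i + (n / k)\<^sup>2)"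
    by (intro sum.cong refl) (simp add: power2_eq_square algebra_simps)
  also have "\<dots> = (\<Sum>i<k. (q i)\<^sup>2) - 2 * (n / k) * (\<Sum>i<k. q i) + k * (n / k)\<^sup>2"
    by (simp only: sum.distrib sum_subtractf sum_distrib_left sum_constant card_lessThan)
  also have "\<dots> = (\<Sum>i<k. (q i)\<^sup>2) - 2 * (n / k) * n + k * (n / k)\<^sup>2"
    by (simp only: n_def)
  also have "\<dots> = (\<Sum>i<k. (q i)\<^sup>2) - n\<^sup>2 / k"
    using assms by (simp add: power2_eq_square field_simps)
  finally show ?thesis by (simp add: n_def)
qed

text \<open>Let \<open>b = card B\<close>. The excluded subgraphs give
  \<open>I \<le> 2 * b * (b + t)\<close>, and edge counting gives
  \<open>b * \<gamma> * n \<le> 2 * f + K + I\<close>. A crude bound on \<open>b\<close> lets the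
  second inequality absorb \<open>I\<close> and \<open>K\<close>, so \<open>b\<close> is of order
  \<open>f / n\<close> and \<open>I\<close> of order \<open>f^2 / n^2\<close>.\<close>

lemma (in fgraph) inner_arcs_bound:
  fixes \<gamma> f K :: real
  defines "n \<equiv> real (card V)"
  assumes k: "k \<ge> 2" and t: "t \<ge> 1" and \<gamma>: "\<gamma> = 1 / (16 * real k ^ 2 * t)"
    and cf: "crit_free V E k t" and mf: "myc_free V E k t"
    and p: "\<And>v. p v < k"
    and cut: "\<And>v i. i < k \<Longrightarrow> card {w. E v w \<and> p w = p v} \<le> card {w. E v w \<and> p w = i}"
    and few: "card (inner_arcs E p) \<le> \<gamma>\<^sup>2 / 16 * n\<^sup>2"
    and low: "(1 - 1 / k) * n\<^sup>2 - 2 * f - K \<le> arcs E V"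
    and fK: "2 * f + K \<le> \<gamma>\<^sup>2 / 16 * n\<^sup>2" "0 \<le> f" "0 \<le> K"
    and large: "8 * t \<le> \<gamma> * n" "4 * K \<le> \<gamma> * n" "4 * k * (real (k * t) + t + 1) \<le> n"
  shows "card (inner_arcs E p) \<le> 128 * (real t + 1) * f\<^sup>2 / (\<gamma>\<^sup>2 * n\<^sup>2)"
proof -
  have \<gamma>0: "\<gamma> > 0" using k t by (simp add: \<gamma>)
  have \<gamma>n: "\<gamma> * n > 0" using large(1) t by linarith
  then have n0: "n > 0" using \<gamma>0 by (simp add: zero_less_mult_iff)
  \<comment> \<open>This identity fixes the 16 in \<gamma>: the greedy embedding avoids what at most
    \<open>2 * k * t\<close> vertices miss, which is a quarter of the lower bound
    \<open>n / (2 * k)\<close> on the class sizes.\<close>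
  have \<gamma>1: "2 * (k * t) * (\<gamma> * n) = n / (8 * k)"
    using k t by (simp add: \<gamma> power2_eq_square)
  have "real k * 1 \<le> real k * (16 * real k * t)"
  proof (intro mult_left_mono)
    have "1 * 1 \<le> (16 * real k) * t" using k t by (intro mult_mono) auto
    then show "1 \<le> 16 * real k * t" by simp
  qed auto
  then have \<gamma>2: "\<gamma> \<le> 1 / k"
    using k t unfolding \<gamma> by (intro divide_left_mono) (auto simp: power2_eq_square algebra_simps)
  define I where "I = real (card (inner_arcs E p))"
  define q where "q i = real (card {v \<in> V. p v = i})" for i
  define M where "M = (\<Sum>v\<in>V. real (card (missing p v)))"
  have sumq: "(\<Sum>i<k. q i) = n"
    unfolding q_def n_def using card_classes(1)[of p k] p by (simp flip: of_nat_sum)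
  define cr where "cr = real (card {(x, y) \<in> V \<times> V. p x \<noteq> p y})"
  have "real ((\<Sum>i<k. card {v \<in> V. p v = i} ^ 2) + card {(x, y) \<in> V \<times> V. p x \<noteq> p y}) = real (card V ^ 2)"
    using card_classes(2)[of p k] p by simp
  then have cross1: "(\<Sum>i<k. (q i)\<^sup>2) + cr = n\<^sup>2"
    by (simp add: q_def cr_def n_def)
  have "real (card {(x, y) \<in> V \<times> V. p x \<noteq> p y} + card (inner_arcs E p)) = real (arcs E V + (\<Sum>v\<in>V. card (missing p v)))"
    by (simp only: card_cross)
  then have cross2: "cr + I = arcs E V + M"
    by (simp add: I_def M_def cr_def)
  have M0: "0 \<le> M" by (simp add: M_def sum_nonneg)
  have dev: "(\<Sum>i<k. (q i - n / k)\<^sup>2) = (\<Sum>i<k. (q i)\<^sup>2) - n\<^sup>2 / k"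
    using sum_square_deviation[of k q] k by (simp add: sumq)
  \<comment> \<open>By \<open>cross1\<close>, \<open>cross2\<close> and \<open>dev\<close>, the sum
    of \<open>M\<close> and the deviation equals \<open>(1 - 1 / k) * n^2 - arcs E V + I\<close>.
    Both summands are nonnegative, so each is at most \<open>2 * f + K + I\<close>.\<close>
  have "0 \<le> (\<Sum>i<k. (q i - n / k)\<^sup>2)" by (simp add: sum_nonneg)
  moreover have "(1 - 1 / k) * n\<^sup>2 = n\<^sup>2 - n\<^sup>2 / k" by (simp add: algebra_simps)
  ultimately have MI: "M \<le> 2 * f + K + I" and devle: "(\<Sum>i<k. (q i - n / k)\<^sup>2) \<le> 2 * f + K + I"
    using low cross1 cross2 dev M0 by linarith+
  have M1: "M \<le> \<gamma>\<^sup>2 / 8 * n\<^sup>2" and devle': "(\<Sum>i<k. (q i - n / k)\<^sup>2) \<le> \<gamma>\<^sup>2 / 8 * n\<^sup>2"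
    using MI devle few fK(1) by (simp_all add: I_def)
  have qi: "n / (2 * k) \<le> q i" if "i < k" for i
  proof -
    have "(q i - n / k)\<^sup>2 \<le> (\<Sum>i<k. (q i - n / k)\<^sup>2)"
      using that by (intro member_le_sum) auto
    also have "\<dots> \<le> \<gamma>\<^sup>2 / 8 * n\<^sup>2" by (rule devle')
    also have "\<dots> \<le> (1 / k)\<^sup>2 / 4 * n\<^sup>2"
    proof (rule mult_right_mono)
      have "\<gamma>\<^sup>2 \<le> (1 / k)\<^sup>2" using \<gamma>0 \<gamma>2 by (intro power_mono) auto
      then show "\<gamma>\<^sup>2 / 8 \<le> (1 / k)\<^sup>2 / 4" using zero_le_power2[of "1 / real k"] by linarith
    qed simp
    also have "\<dots> = (n / (2 * k))\<^sup>2" by (simp add: power2_eq_square)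
    finally have "\<bar>q i - n / k\<bar> \<le> n / (2 * k)"
      using n0 by (intro power2_le_imp_le[of "\<bar>q i - n / k\<bar>"]) auto
    moreover have "n / k = n / (2 * k) + n / (2 * k)" by simp
    ultimately show ?thesis by linarith
  qed
  define B where "B = {v \<in> V. \<gamma> * n < card (missing p v)}"
  have BV: "B \<subseteq> V" and fB: "finite B" using finite_V by (auto simp: B_def)
  define b where "b = real (card B)"
  have b0: "0 \<le> b" by (simp add: b_def)
  have "b * (\<gamma> * n) = (\<Sum>v\<in>B. \<gamma> * n)" by (simp add: b_def)
  also have "\<dots> \<le> (\<Sum>v\<in>B. real (card (missing p v)))"
    by (intro sum_mono) (auto simp: B_def)
  also have "\<dots> \<le> M" unfolding M_def using BV finite_V by (intro sum_mono2) auto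
  finally have bM: "b * (\<gamma> * n) \<le> M" .
  also have "\<dots> \<le> \<gamma>\<^sup>2 / 8 * n\<^sup>2" by (rule M1)
  also have "\<dots> = (\<gamma> * n / 8) * (\<gamma> * n)" by (simp add: power2_eq_square)
  finally have b1: "b \<le> \<gamma> * n / 8" using \<gamma>n by (simp only: mult_le_cancel_right_pos)
  have b2: "b \<le> n / (8 * k)"
  proof -
    have "\<gamma> * n \<le> 1 / k * n" using \<gamma>2 n0 by (intro mult_right_mono) auto
    then show ?thesis using b1 by (simp add: field_simps)
  qed
  \<comment> \<open>The budget \<open>n / (2 * k)\<close> splits into \<open>n / (8 * k)\<close> for
    missed vertices, \<open>n / (8 * k)\<close> for \<open>B\<close> and \<open>n / (4 * k)\<close>
    for \<open>Z\<close> and the new class. The bounds on \<open>S\<close> and \<open>Z\<close> fit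
    both uses: a pair \<open>x\<close>, \<open>y\<close>, and \<open>k * t\<close> neighbours
    together with an apex.\<close>
  have embed: "\<exists>D. (\<forall>i<k. D i \<subseteq> {v \<in> V. p v = i} - B - Z) \<and> multipartite V E k t D \<and>
             (\<forall>i<k. \<forall>x\<in>D i. \<forall>s\<in>S. p s \<noteq> i \<longrightarrow> E x s)"
    if S: "S \<subseteq> V - B" "card S \<le> k * t" and Z: "finite Z" "card Z \<le> k * t + 1" for S Z
  proof (rule greedy_multipartite[OF S(1) BV _ Z(1) less_imp_le[OF \<gamma>n] _ order_refl])
    show "real (card (missing p v)) \<le> \<gamma> * n" if "v \<in> V - B" for v
      using that by (auto simp: B_def not_less)
    fix i assume "i < k"
    have "real (card S + k * t) * (\<gamma> * n) \<le> real (2 * (k * t)) * (\<gamma> * n)"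
      using S(2) \<gamma>n by (intro mult_right_mono of_nat_mono) auto
    moreover have "real (2 * (k * t)) * (\<gamma> * n) = n / (8 * k)" using \<gamma>1 by simp
    moreover have "real (card Z) \<le> real (k * t) + 1" using Z(2) by linarith
    moreover have "real (k * t) + t + 1 \<le> n / (4 * k)"
      using large(3) k by (simp add: field_simps)
    moreover have "n / (8 * k) + n / (8 * k) + n / (4 * k) = n / (2 * k)"
      by (simp add: field_simps)
    ultimately have "real (card S + k * t) * (\<gamma> * n) + b + card Z + t \<le> n / (2 * k)"
      using b2 by linarith
    then show "real (card S + k * t) * (\<gamma> * n) + card B + card Z + t \<le> card {v \<in> V. p v = i}"
      using qi[OF \<open>i < k\<close>] by (simp add: q_def b_def)
  qed
  have kt: "2 \<le> k * t" using k t by (metis mult_le_mono nat_mult_1_right)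
  have cover: "x \<in> B \<or> y \<in> B" if "(x, y) \<in> inner_arcs E p" for x y
  proof (rule ccontr)
    assume nb: "\<not> (x \<in> B \<or> y \<in> B)"
    have xy: "E x y" "p x = p y" using that by (auto simp: inner_arcs_def)
    have c: "card {x, y} \<le> 2" by (simp add: card_insert_if)
    have "x \<in> V" "y \<in> V" using E_V[OF xy(1)] E_V[OF E_sym[OF xy(1)]] by auto
    then have SV: "{x, y} \<subseteq> V - B" using nb by blast
    have "\<exists>D. (\<forall>i<k. D i \<subseteq> {v \<in> V. p v = i} - B - {x, y}) \<and> multipartite V E k t D \<and>
        (\<forall>i<k. \<forall>u\<in>D i. \<forall>s\<in>{x, y}. p s \<noteq> i \<longrightarrow> E u s)"
      by (rule embed[OF SV]) (use c kt in auto)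
    then obtain D where D: "\<forall>i<k. D i \<subseteq> {v \<in> V. p v = i} - B - {x, y}" "multipartite V E k t D"
      "\<forall>i<k. \<forall>u\<in>D i. \<forall>s\<in>{x, y}. p s \<noteq> i \<longrightarrow> E u s"
      by (elim exE conjE)
    have "\<forall>j<k. x \<notin> D j \<and> y \<notin> D j" using D(1) by blast
    moreover have "\<forall>j<k. j \<noteq> p x \<longrightarrow> (\<forall>w\<in>D j. E x w \<and> E y w)"
      using D(3) xy(2) E_sym by (metis insertCI)
    ultimately show False
      using cf p[of x] xy(1) D(2) unfolding crit_free_def by blast
  qed
  \<comment> \<open>By \<open>cut\<close>, a larger inner degree occurs towards every class, leaving
    \<open>t\<close> neighbours outside \<open>B\<close> in each. The apex \<open>v\<close> may
    itself lie in \<open>B\<close>, since it needs no adjacency to the classes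
    \<open>D i\<close>.\<close>
  have deg: "card {w. E v w \<and> p w = p v} \<le> card B + t" for v
  proof (rule ccontr)
    assume contr: "\<not> ?thesis"
    have "\<exists>W. W \<subseteq> {w. E v w \<and> p w = i} - B \<and> card W = t" if "i < k" for i
    proof -
      have "card B + t \<le> card {w. E v w \<and> p w = i}" using cut[OF that, of v] contr by linarith
      moreover have "card {w. E v w \<and> p w = i} - card B \<le> card ({w. E v w \<and> p w = i} - B)"
        by (rule diff_card_le_card_Diff[OF fB])
      ultimately have "t \<le> card ({w. E v w \<and> p w = i} - B)" by linarith
      then show ?thesis by (meson obtain_subset_with_card_n)
    qed
    then obtain W where W: "\<And>i. i < k \<Longrightarrow> W i \<subseteq> {w. E v w \<and> p w = i} - B"
      "\<And>i. i < k \<Longrightarrow> card (W i) = t" by metis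
    define S where "S = (\<Union>i<k. W i)"
    have SV: "S \<subseteq> V - B" using W(1) nbh_subset unfolding S_def by fastforce
    have fS: "finite S" using SV finite_V finite_subset by blast
    have "card S \<le> (\<Sum>i<k. card (W i))" unfolding S_def by (rule card_UN_le) simp
    then have cS: "card S \<le> k * t" using W(2) by simp
    then have "card (insert v S) \<le> k * t + 1" using fS by (simp add: card_insert_if)
    then obtain D where D: "\<forall>i<k. D i \<subseteq> {v \<in> V. p v = i} - B - insert v S" "multipartite V E k t D"
      "\<forall>i<k. \<forall>u\<in>D i. \<forall>s\<in>S. p s \<noteq> i \<longrightarrow> E u s"
      using embed[OF SV cS, of "insert v S"] fS by blast
    have "multipartite V E k t D \<and>
        (\<forall>i<k. W i \<subseteq> V \<and> card (W i) = t \<and> v \<notin> D i \<and> D i \<inter> W i = {} \<and> (\<forall>w\<in>W i. E v w)) \<and>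
        (\<forall>i<k. \<forall>j<k. i \<noteq> j \<longrightarrow> W i \<inter> W j = {} \<and> (\<forall>x\<in>D i. \<forall>y\<in>W j. E x y))"
    proof (intro conjI allI impI ballI)
      fix i assume i: "i < k"
      show "W i \<subseteq> V" using i SV by (auto simp: S_def)
      show "v \<notin> D i" using D(1) i by blast
      show "D i \<inter> W i = {}" using D(1) i by (fastforce simp: S_def)
      show "E v w" if "w \<in> W i" for w using W(1)[OF i] that by blast
    next
      fix i j assume ij: "i < k" "j < k" "i \<noteq> j"
      then show "W i \<inter> W j = {}" using W(1)[of i] W(1)[of j] by auto
      fix x y assume "x \<in> D i" "y \<in> W j"
      moreover have "y \<in> S" "p y = j" using \<open>y \<in> W j\<close> W(1)[of j] ij by (auto simp: S_def)
      ultimately show "E x y" using D(3) ij by metis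
    qed (use D(2) W(2) in auto)
    then show False using mf unfolding myc_free_def by blast
  qed
  \<comment> \<open>By \<open>cover\<close>, each inner arc or its reversal starts in
    \<open>B\<close>.\<close>
  let ?J = "SIGMA v:B. {w. E v w \<and> p w = p v}"
  have fN: "finite {w. E v w \<and> p w = p v}" for v
    by (rule finite_subset[of _ "Collect (E v)"]) auto
  have fJ: "finite ?J"
    using fB fN by (intro finite_SigmaI)
  have "inner_arcs E p \<subseteq> ?J \<union> prod.swap ` ?J"
  proof
    fix e assume e: "e \<in> inner_arcs E p"
    obtain x y where xy: "e = (x, y)" by (cases e)
    have "E x y" "E y x" "p x = p y" using e xy E_sym by (auto simp: inner_arcs_def)
    moreover have "x \<in> B \<or> y \<in> B" using cover e xy by blast
    ultimately have "(x, y) \<in> ?J \<or> (y, x) \<in> ?J" by auto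
    then show "e \<in> ?J \<union> prod.swap ` ?J"
    proof
      assume "(y, x) \<in> ?J"
      then have "prod.swap (y, x) \<in> prod.swap ` ?J" by (rule imageI)
      then show ?thesis by (simp add: xy)
    qed (simp add: xy)
  qed
  then have "card (inner_arcs E p) \<le> card (?J \<union> prod.swap ` ?J)"
    using fJ by (intro card_mono) auto
  also have "\<dots> \<le> card ?J + card (prod.swap ` ?J)" by (rule card_Un_le)
  also have "\<dots> \<le> 2 * card ?J" using card_image_le[OF fJ, of prod.swap] by linarith
  also have "card ?J = (\<Sum>v\<in>B. card {w. E v w \<and> p w = p v})"
    using fB fN by (intro card_SigmaI) auto
  also have "\<dots> \<le> (\<Sum>v\<in>B. card B + t)" by (intro sum_mono deg)
  finally have "card (inner_arcs E p) \<le> 2 * (card B * (card B + t))" by simp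
  then have "I \<le> real (2 * (card B * (card B + t)))" unfolding I_def by (rule of_nat_mono)
  then have Ib: "I \<le> 2 * (b * (b + t))" by (simp add: b_def)
  show ?thesis
  \<comment> \<open>If \<open>B\<close> is empty there are no inner arcs. Otherwise
    \<open>b \<ge> 1\<close>, so \<open>K\<close> and \<open>t\<close> are bounded by multiples of
    \<open>b\<close>.\<close>
  proof (cases "card B = 0")
    case True
    then have "I \<le> 0" using Ib by (simp add: b_def)
    moreover have "0 \<le> 128 * (real t + 1) * f\<^sup>2 / (\<gamma>\<^sup>2 * n\<^sup>2)" by simp
    ultimately show ?thesis by (simp only: I_def order_trans)
  next
    case False
    then have b3: "1 \<le> b" by (simp add: b_def)
    have "b * (b + t) \<le> b * (\<gamma> * n / 4)"
      using b1 large(1) b0 by (intro mult_left_mono) auto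
    moreover have "1 * (\<gamma> * n) \<le> b * (\<gamma> * n)" using b3 \<gamma>n by (intro mult_right_mono) auto
    \<comment> \<open>Here \<open>I\<close> is at most half and \<open>K\<close> at most a quarter
      of \<open>b * \<gamma> * n\<close>; the remaining quarter is at most
      \<open>2 * f\<close>.\<close>
    ultimately have "b * (\<gamma> * n) \<le> 8 * f"
      using bM MI Ib large(2) by (simp add: algebra_simps)
    then have "b \<le> 8 * f / (\<gamma> * n)" using \<gamma>n by (simp add: field_simps)
    then have "b\<^sup>2 \<le> (8 * f / (\<gamma> * n))\<^sup>2" using b0 by (intro power_mono)
    then have bb: "b\<^sup>2 \<le> 64 * f\<^sup>2 / (\<gamma>\<^sup>2 * n\<^sup>2)" by (simp add: power_divide power_mult_distrib)
    have "b + t \<le> (real t + 1) * b"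
    proof -
      have "real t * 1 \<le> t * b" using b3 by (intro mult_left_mono) auto
      then show ?thesis by (simp add: algebra_simps)
    qed
    then have "b * (b + t) \<le> b * ((real t + 1) * b)" using b0 by (rule mult_left_mono)
    then have "I \<le> 2 * (real t + 1) * b\<^sup>2" using Ib by (simp add: power2_eq_square algebra_simps)
    also have "\<dots> \<le> 2 * (real t + 1) * (64 * f\<^sup>2 / (\<gamma>\<^sup>2 * n\<^sup>2))"
      using bb by (intro mult_left_mono) auto
    also have "\<dots> = 128 * (real t + 1) * f\<^sup>2 / (\<gamma>\<^sup>2 * n\<^sup>2)"
      by (simp add: algebra_simps)
    finally show ?thesis by (simp add: I_def)
  qed
qed

section \<open>From edge sets to relations, and Turan numbers\<close>

lemma simple_graph_fgraph:
  assumes "simple_graph G"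
  shows "fgraph (verts G) (\<lambda>x y. {x, y} \<in> edges G)"
proof
  show "finite (verts G)" using assms by (simp add: simple_graph_def)
  show "{y, x} \<in> edges G" if "{x, y} \<in> edges G" for x y
    using that by (simp add: insert_commute)
  show "{x, x} \<notin> edges G" for x
    using assms by (auto simp: simple_graph_def)
  show "x \<in> verts G" if "{x, y} \<in> edges G" for x y
    using assms that by (auto simp: simple_graph_def)
qed

lemma card_arcs_of_edges:
  assumes "finite F" "\<And>e. e \<in> F \<Longrightarrow> card e = 2"
  shows "card {(x, y). {x, y} \<in> F} = 2 * card F"
proof -
  have two: "finite {(x, y). {x, y} = e} \<and> card {(x, y). {x, y} = e} = 2" if e: "e \<in> F" for e
  proof -
    obtain a b where "e = {a, b}" "a \<noteq> b"
      using assms(2)[OF e] by (auto simp: card_2_iff)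
    then have "{(x, y). {x, y} = e} = {(a, b), (b, a)}"
      by (auto simp: doubleton_eq_iff)
    then show ?thesis using \<open>a \<noteq> b\<close> by simp
  qed
  have "{(x, y). {x, y} \<in> F} = (\<Union>e\<in>F. {(x, y). {x, y} = e})" by auto
  also have "card \<dots> = (\<Sum>e\<in>F. card {(x, y). {x, y} = e})"
    by (rule card_UN_disjoint) (use assms two in auto)
  also have "\<dots> = 2 * card F" using two by simp
  finally show ?thesis .
qed

lemma finite_edges: "simple_graph G \<Longrightarrow> finite (edges G)"
  unfolding simple_graph_def by (meson Pow_iff finite_Pow_iff finite_subset subsetI)

lemma arcs_eq_edges:
  assumes "simple_graph G"
  shows "arcs (\<lambda>x y. {x, y} \<in> edges G) (verts G) = 2 * card (edges G)"
proof -
  have "{(x, y). x \<in> verts G \<and> y \<in> verts G \<and> {x, y} \<in> edges G} = {(x, y). {x, y} \<in> edges G}"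
    using assms by (auto simp: simple_graph_def)
  then show ?thesis
    unfolding arcs_def
    using card_arcs_of_edges[OF finite_edges[OF assms]] assms by (simp add: simple_graph_def)
qed

text \<open>The quotient by \<open>k\<close> determines a member of a residue class, so both the
  size of the class and \<open>n / k\<close> lie between \<open>n div k\<close> and
  \<open>n div k + 1\<close>.\<close>

lemma card_residue_class:
  fixes k n i :: nat
  assumes "i < k"
  shows "\<bar>real (card {v \<in> {..<n}. v mod k = i}) - n / k\<bar> \<le> 1"
proof -
  let ?R = "{v \<in> {..<n}. v mod k = i}"
  have "inj_on (\<lambda>v. v div k) ?R"
    by (rule inj_onI) (metis (mono_tags, lifting) div_mult_mod_eq mem_Collect_eq)
  moreover have "(\<lambda>v. v div k) ` ?R \<subseteq> {..n div k}"
    by (auto intro: div_le_mono)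
  ultimately have "card ?R \<le> card {..n div k}"
    by (intro card_inj_on_le[of "\<lambda>v. v div k"]) auto
  then have up: "card ?R \<le> n div k + 1" by simp
  have "(\<lambda>q. q * k + i) ` {..<n div k} \<subseteq> ?R"
  proof (intro subsetI, elim imageE)
    fix v q assume v: "v = q * k + i" and "q \<in> {..<n div k}"
    then have "Suc q \<le> n div k" by simp
    then have "Suc q * k \<le> n div k * k" by (rule mult_le_mono1)
    also have "\<dots> \<le> n" by simp
    finally show "v \<in> ?R" using assms by (simp add: v)
  qed
  moreover have "inj_on (\<lambda>q. q * k + i) {..<n div k}"
    using assms by (intro inj_onI) auto
  ultimately have "card {..<n div k} \<le> card ?R"
    by (intro card_inj_on_le[of "\<lambda>q. q * k + i"]) auto
  then have lo: "n div k \<le> card ?R" by simp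
  have "real (n div k) * k \<le> n"
    by (metis div_times_less_eq_dividend of_nat_le_iff of_nat_mult)
  then have "real (n div k) \<le> n / k" using assms by (simp add: field_simps)
  moreover have "n / k \<le> real (n div k) + 1"
  proof -
    have "n \<le> (n div k + 1) * k"
      using assms dividend_less_div_times[of k n] by simp
    then have "real n \<le> real ((n div k + 1) * k)" by (rule of_nat_mono)
    then show ?thesis using assms by (simp add: field_simps)
  qed
  ultimately show ?thesis using up lo by linarith
qed

text \<open>The sum of squared class sizes is \<open>n^2 / k\<close> plus the squared deviations;
  each of the \<open>k\<close> deviations is at most 1, which accounts for the loss
  \<open>k\<close>.\<close>

lemma turan_number_lower_bound:
  fixes k n :: nat
  assumes "k \<ge> 1"
  shows "(1 - 1 / k) * real n ^ 2 - k \<le> 2 * turan_number k n"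
proof -
  \<comment> \<open>\<open>card_classes\<close> concerns only the vertex set, so the edgeless graph
    gives access to it.\<close>
  interpret fgraph "{..<n}" "\<lambda>_ _. False" by unfold_locales auto
  define q where "q i = real (card {v \<in> {..<n}. v mod k = i})" for i
  have p: "v mod k < k" for v using assms by simp
  have sumq: "(\<Sum>i<k. q i) = n"
    using card_classes(1)[of "\<lambda>v. v mod k" k, OF p] by (simp add: q_def flip: of_nat_sum)
  have T: "simple_graph (turan_graph k n)"
    by (auto simp: simple_graph_def turan_graph_def card_2_iff)
  have "2 * card (edges (turan_graph k n)) = card {(x, y). {x, y} \<in> edges (turan_graph k n)}"
    by (rule card_arcs_of_edges[OF finite_edges[OF T], symmetric]) (use T in \<open>simp add: simple_graph_def\<close>)
  also have "{(x, y). {x, y} \<in> edges (turan_graph k n)} = {(x, y) \<in> {..<n} \<times> {..<n}. x mod k \<noteq> y mod k}"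
    by (auto simp: turan_graph_def doubleton_eq_iff)
  finally have "(\<Sum>i<k. card {v \<in> {..<n}. v mod k = i} ^ 2) + 2 * turan_number k n = n ^ 2"
    using card_classes(2)[of "\<lambda>v. v mod k" k, OF p] by (simp add: turan_number_def)
  then have "real ((\<Sum>i<k. card {v \<in> {..<n}. v mod k = i} ^ 2) + 2 * turan_number k n) = real (n ^ 2)"
    by (rule arg_cong)
  then have "(\<Sum>i<k. (q i)\<^sup>2) + 2 * turan_number k n = real n ^ 2"
    by (simp add: q_def)
  moreover have "(\<Sum>i<k. (q i)\<^sup>2) - real n ^ 2 / k = (\<Sum>i<k. (q i - n / k)\<^sup>2)"
    using sum_square_deviation[OF assms, of q] by (simp add: sumq)
  moreover have "(\<Sum>i<k. (q i - n / k)\<^sup>2) \<le> (\<Sum>i<k. 1)"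
  proof (rule sum_mono)
    fix i assume "i \<in> {..<k}"
    then have "\<bar>q i - n / k\<bar> \<le> 1" unfolding q_def by (intro card_residue_class) simp
    then show "(q i - n / k)\<^sup>2 \<le> 1" by (simp add: abs_square_le_1)
  qed
  ultimately show ?thesis by (simp add: algebra_simps)
qed

section \<open>Embedding \<open>H\<close> into the excluded configurations\<close>

text \<open>If the ends of the critical edge had different colours in a \<open>k\<close>-colouring
  of the graph without it, that colouring would be proper for \<open>H\<close>.\<close>

lemma critical_edge_colouring:
  assumes H: "simple_graph H" and e: "critical_edge H e" and chi: "chromatic_number H = k + 1"
  obtains u v c where "e = {u, v}" "u \<noteq> v" "u \<in> verts H" "v \<in> verts H" "c ` verts H \<subseteq> {..<k}"
    "c u = c v" "\<And>x y. {x, y} \<in> edges H \<Longrightarrow> {x, y} \<noteq> {u, v} \<Longrightarrow> c x \<noteq> c y"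
proof -
  let ?H = "delete_edges H {e}"
  have eH: "e \<in> edges H" and chi': "chromatic_number ?H = k"
    using e chi by (auto simp: critical_edge_def)
  obtain u v where uv: "e = {u, v}" "u \<noteq> v" "u \<in> verts H" "v \<in> verts H"
    using H eH unfolding simple_graph_def by (metis card_2_iff insert_subset)
  have "finite (verts H)" using H by (simp add: simple_graph_def)
  then obtain g where "bij_betw g (verts H) {0..<card (verts H)}"
    using ex_bij_betw_finite_nat by blast
  then have g: "inj_on g (verts H)" "g ` verts H = {0..<card (verts H)}"
    by (auto simp: bij_betw_def)
  \<comment> \<open>Some proper colouring must exist before the \<open>LEAST\<close> in
    \<open>chromatic_number\<close> is known to be attained; an injective one serves.\<close>
  have "proper_colouring ?H (card (verts H)) g"
    unfolding proper_colouring_def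
  proof (intro conjI allI impI)
    fix x y assume "{x, y} \<in> edges ?H"
    then have "{x, y} \<subseteq> verts H" "card {x, y} = 2"
      using H by (auto simp: simple_graph_def delete_edges_def)
    then show "g x \<noteq> g y" using g(1) by (auto simp: inj_on_eq_iff)
  qed (use g(2) in \<open>auto simp: delete_edges_def\<close>)
  then have "\<exists>k c. proper_colouring ?H k c" by blast
  then have "\<exists>c. proper_colouring ?H (chromatic_number ?H) c"
    unfolding chromatic_number_def by (rule LeastI_ex)
  then obtain c where c: "proper_colouring ?H k c" using chi' by auto
  have c1: "c ` verts H \<subseteq> {..<k}"
    and c2: "\<And>x y. {x, y} \<in> edges H \<Longrightarrow> {x, y} \<noteq> {u, v} \<Longrightarrow> c x \<noteq> c y"
    using c uv(1) by (auto simp: proper_colouring_def delete_edges_def)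
  have "c u = c v"
  proof (rule ccontr)
    assume "c u \<noteq> c v"
    then have "proper_colouring H k c"
      unfolding proper_colouring_def using c1 c2 by (metis doubleton_eq_iff)
    then have "chromatic_number H \<le> k"
      unfolding chromatic_number_def by (intro Least_le) blast
    then show False using chi by simp
  qed
  then show thesis using that uv c1 c2 by blast
qed

text \<open>The critical edge is mapped to \<open>x\<close>, \<open>y\<close>, and every other
  vertex into the class given by its colour. As \<open>t\<close> is at least the order of
  \<open>H\<close>, no class is too small.\<close>

lemma crit_free_if_free_of:
  assumes H: "simple_graph H" and e: "critical_edge H e" and chi: "chromatic_number H = k + 1"
    and G: "simple_graph G" and free: "free_of H G" and t: "card (verts H) \<le> t"
  shows "crit_free (verts G) (\<lambda>x y. {x, y} \<in> edges G) k t"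
  unfolding crit_free_def
proof clarify
  fix x y i D
  assume i: "i < k" and D: "multipartite (verts G) (\<lambda>x y. {x, y} \<in> edges G) k t D"
    and xy: "{x, y} \<in> edges G" and nD: "\<forall>j<k. x \<notin> D j \<and> y \<notin> D j"
    and adj: "\<forall>j<k. j \<noteq> i \<longrightarrow> (\<forall>w\<in>D j. {x, w} \<in> edges G \<and> {y, w} \<in> edges G)"
  interpret fgraph "verts G" "\<lambda>x y. {x, y} \<in> edges G" by (rule simple_graph_fgraph[OF G])
  obtain u v c where uv: "u \<noteq> v" "u \<in> verts H" "v \<in> verts H" and c: "c ` verts H \<subseteq> {..<k}"
    "c u = c v" "\<And>x y. {x, y} \<in> edges H \<Longrightarrow> {x, y} \<noteq> {u, v} \<Longrightarrow> c x \<noteq> c y"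
    by (rule critical_edge_colouring[OF H e chi]) blast
  \<comment> \<open>The colours \<open>c u\<close> and \<open>i\<close> are swapped, so that the
    critical edge lands in class \<open>i\<close>.\<close>
  define col where "col w = (if c w = c u then i else if c w = i then c u else c w)" for w
  have cu: "c u < k" using c(1) uv(2) by auto
  have col: "col u = i" "col v = i" "\<And>w. w \<in> verts H \<Longrightarrow> col w < k"
    "\<And>x y. {x, y} \<in> edges H \<Longrightarrow> {x, y} \<noteq> {u, v} \<Longrightarrow> col x \<noteq> col y"
  proof -
    show "col u = i" "col v = i" using c(2) by (auto simp: col_def)
    show "col w < k" if "w \<in> verts H" for w using c(1) cu i that by (auto simp: col_def)
    have "col x \<noteq> col y" if "c x \<noteq> c y" for x y using that by (auto simp: col_def)
    then show "col x \<noteq> col y" if "{x, y} \<in> edges H" "{x, y} \<noteq> {u, v}" for x y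
      using c(3)[OF that] by blast
  qed
  have "\<exists>g. inj_on g (verts H) \<and> g ` verts H \<subseteq> D j" if "j < k" for j
  proof -
    have "card (verts H) \<le> card (D j)" using D t that by (simp add: multipartite_def)
    then show ?thesis
      using card_le_inj[of "verts H" "D j"] multipartite_finite[OF D that] H
      by (auto simp: simple_graph_def)
  qed
  then obtain g where g: "\<And>j. j < k \<Longrightarrow> inj_on (g j) (verts H)"
    "\<And>j w. j < k \<Longrightarrow> w \<in> verts H \<Longrightarrow> g j w \<in> D j"
    by (metis image_subset_iff)
  define \<phi> where "\<phi> w = (if w = u then x else if w = v then y else g (col w) w)" for w
  have \<phi>: "\<phi> u = x" "\<phi> v = y" "\<And>w. w \<in> verts H \<Longrightarrow> w \<noteq> u \<Longrightarrow> w \<noteq> v \<Longrightarrow> \<phi> w = g (col w) w"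
    using uv by (auto simp: \<phi>_def)
  have \<phi>D: "\<phi> w \<in> D (col w)" if "w \<in> verts H" "w \<noteq> u" "w \<noteq> v" for w
    using that g(2) col(3) \<phi>(3) by auto
  have xyV: "x \<in> verts G" "y \<in> verts G" "x \<noteq> y"
    using xy E_irrefl E_V E_sym by blast+
  have nxy: "\<phi> w \<noteq> x" "\<phi> w \<noteq> y" if "w \<in> verts H" "w \<noteq> u" "w \<noteq> v" for w
    using \<phi>D[OF that] nD col(3)[OF that(1)] by auto
  have "inj_on \<phi> (verts H)"
  proof (rule inj_onI)
    fix w w' assume w: "w \<in> verts H" "w' \<in> verts H" and eq: "\<phi> w = \<phi> w'"
    show "w = w'"
    proof (cases "w \<in> {u, v} \<or> w' \<in> {u, v}")
      case True
      then show ?thesis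
        using eq w \<phi>(1,2) xyV(3) nxy(1)[of w] nxy(2)[of w] nxy(1)[of w'] nxy(2)[of w']
        by (cases "w = u"; cases "w = v"; cases "w' = u"; cases "w' = v") auto
    next
      case False
      then have D2: "\<phi> w \<in> D (col w)" "\<phi> w' \<in> D (col w')" using \<phi>D w by auto
      have "col w = col w'"
        using D2 eq multipartite_disjoint[OF D col(3)[OF w(1)] col(3)[OF w(2)]] by auto
      moreover have "\<phi> w = g (col w) w" "\<phi> w' = g (col w') w'" using \<phi>(3) w False by auto
      ultimately show ?thesis
        using eq g(1)[OF col(3)[OF w(1)]] w by (metis inj_onD)
    qed
  qed
  moreover have "\<phi> ` verts H \<subseteq> verts G"
  proof clarify
    fix w assume w: "w \<in> verts H"
    show "\<phi> w \<in> verts G"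
    proof (cases "w \<in> {u, v}")
      case True
      then show ?thesis using \<phi>(1,2) xyV by auto
    next
      case False
      then show ?thesis
        using \<phi>D[OF w] col(3)[OF w] D unfolding multipartite_def by auto
    qed
  qed
  moreover have "\<phi> ` e \<in> edges G" if eH: "e \<in> edges H" for e
  proof -
    \<comment> \<open>Every edge other than the critical one has an endpoint outside
      \<open>{u, v}\<close>; it takes the role of \<open>b\<close>.\<close>
    have adj': "{\<phi> a, \<phi> b} \<in> edges G"
      if ab: "a \<in> verts H" "b \<in> verts H" "col a \<noteq> col b" "b \<notin> {u, v}" for a b
    proof -
      have b: "\<phi> b \<in> D (col b)" using \<phi>D ab by auto
      show ?thesis
      proof (cases "a \<in> {u, v}")
        case True
        then have "col b \<noteq> i" using ab(3) col by auto
        then show ?thesis using True b adj col(3)[OF ab(2)] \<phi>(1,2) by auto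
      next
        case False
        then have "\<phi> a \<in> D (col a)" using \<phi>D ab by auto
        then show ?thesis
          using D b ab(3) col(3)[OF ab(1)] col(3)[OF ab(2)] unfolding multipartite_def by blast
      qed
    qed
    obtain a b where ab: "e = {a, b}" "a \<noteq> b" "a \<in> verts H" "b \<in> verts H"
      using H eH unfolding simple_graph_def by (metis card_2_iff insert_subset)
    show ?thesis
    proof (cases "e = {u, v}")
      case True
      then show ?thesis using \<phi>(1,2) xy by simp
    next
      case False
      then have ne: "col a \<noteq> col b" using col(4)[of a b] eH ab(1) by simp
      have "a \<notin> {u, v} \<or> b \<notin> {u, v}" using False ab by auto
      then show ?thesis
      proof
        assume "b \<notin> {u, v}"
        then show ?thesis using adj'[OF ab(3,4) ne] ab(1) by simp
      next
        assume "a \<notin> {u, v}"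
        then show ?thesis using adj'[OF ab(4,3) ne[symmetric]] ab(1) by (simp add: insert_commute)
      qed
    qed
  qed
  ultimately have "is_subgraph H G" unfolding is_subgraph_def by blast
  then show False using free by (simp add: free_of_def)
qed

lemma is_subgraph_trans:
  assumes "is_subgraph F G" "is_subgraph G H"
  shows "is_subgraph F H"
proof -
  obtain f where f: "inj_on f (verts F)" "f ` verts F \<subseteq> verts G" "\<forall>e\<in>edges F. f ` e \<in> edges G"
    using assms(1) unfolding is_subgraph_def by (elim exE conjE)
  obtain g where g: "inj_on g (verts G)" "g ` verts G \<subseteq> verts H" "\<forall>e\<in>edges G. g ` e \<in> edges H"
    using assms(2) unfolding is_subgraph_def by (elim exE conjE)
  have "inj_on (g \<circ> f) (verts F)" using f g by (meson comp_inj_on inj_on_subset)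
  moreover have "(g \<circ> f) ` verts F \<subseteq> verts H" using f(2) g(2) by auto
  moreover have "\<forall>e\<in>edges F. (g \<circ> f) ` e \<in> edges H" using f(3) g(3) by (metis image_comp)
  ultimately show ?thesis unfolding is_subgraph_def by blast
qed

lemma blown_up_mycielskian_edgeE:
  assumes "e \<in> edges (blown_up_mycielskian k a b c)"
  obtains (VV) i j i' j' where "e = {MV i j, MV i' j'}" "i < k" "i' < k" "j < a" "j' < a" "i \<noteq> i'"
  | (VW) i j i' j' where "e = {MV i j, MW i' j'}" "i < k" "i' < k" "j < a" "j' < b" "i \<noteq> i'"
  | (WU) i j l where "e = {MW i j, MU l}" "i < k" "j < b" "l < c"
proof -
  consider "e \<in> (\<Union>i<k. \<Union>j\<in>{..<k} - {i}. complete_between (MV i ` {..<a}) (MV j ` {..<a}))"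
    | "e \<in> (\<Union>i<k. \<Union>j\<in>{..<k} - {i}. complete_between (MV i ` {..<a}) (MW j ` {..<b}))"
    | "e \<in> (\<Union>i<k. complete_between (MW i ` {..<b}) (MU ` {..<c}))"
    using assms unfolding blown_up_mycielskian_def Let_def graph.sel by (elim UnE)
  then show thesis
  proof cases
    case 1
    then obtain i i' where "i < k" "i' < k" "i \<noteq> i'"
      "e \<in> complete_between (MV i ` {..<a}) (MV i' ` {..<a})"
      by (elim UN_E) auto
    then show thesis using VV by (auto simp: complete_between_def)
  next
    case 2
    then obtain i i' where "i < k" "i' < k" "i \<noteq> i'"
      "e \<in> complete_between (MV i ` {..<a}) (MW i' ` {..<b})"
      by (elim UN_E) auto
    then show thesis using VW by (auto simp: complete_between_def)
  next
    case 3
    then obtain i x y where "i < k" "e = {x, y}" "x \<in> MW i ` {..<b}" "y \<in> MU ` {..<c}"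
      unfolding complete_between_def by auto
    then show thesis using WU by auto
  qed
qed

text \<open>A forbidden configuration contains the blown-up Mycielskian with classes of size
  \<open>a \<le> t\<close>, and therefore \<open>H\<close>.\<close>

lemma myc_free_if_free_of:
  assumes M: "is_subgraph H (blown_up_mycielskian k a a 1)"
    and G: "simple_graph G" and free: "free_of H G" and t: "a \<le> t" and pos: "0 < k" "0 < a"
  shows "myc_free (verts G) (\<lambda>x y. {x, y} \<in> edges G) k t"
  unfolding myc_free_def
proof (rule notI, elim exE conjE)
  fix z D W
  assume D: "multipartite (verts G) (\<lambda>x y. {x, y} \<in> edges G) k t D"
    and W: "\<forall>i<k. W i \<subseteq> verts G \<and> card (W i) = t \<and> z \<notin> D i \<and> D i \<inter> W i = {} \<and>
              (\<forall>w\<in>W i. {z, w} \<in> edges G)"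
    and DW: "\<forall>i<k. \<forall>j<k. i \<noteq> j \<longrightarrow> W i \<inter> W j = {} \<and> (\<forall>x\<in>D i. \<forall>y\<in>W j. {x, y} \<in> edges G)"
  interpret fgraph "verts G" "\<lambda>x y. {x, y} \<in> edges G" by (rule simple_graph_fgraph[OF G])
  have inj: "\<exists>g. inj_on g {..<a} \<and> g ` {..<a} \<subseteq> A" if "A \<subseteq> verts G" "card A = t" for A
    using card_le_inj[of "{..<a}" A] that t finite_V finite_subset[of A] by auto
  have "\<exists>g. inj_on g {..<a} \<and> g ` {..<a} \<subseteq> D i" if "i < k" for i
    using that D by (intro inj) (auto simp: multipartite_def)
  then obtain d where d: "\<And>i. i < k \<Longrightarrow> inj_on (d i) {..<a}" "\<And>i j. i < k \<Longrightarrow> j < a \<Longrightarrow> d i j \<in> D i"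
    by (metis image_subset_iff lessThan_iff)
  have "\<exists>g. inj_on g {..<a} \<and> g ` {..<a} \<subseteq> W i" if "i < k" for i
    using that W by (intro inj) auto
  then obtain w where w: "\<And>i. i < k \<Longrightarrow> inj_on (w i) {..<a}" "\<And>i j. i < k \<Longrightarrow> j < a \<Longrightarrow> w i j \<in> W i"
    by (metis image_subset_iff lessThan_iff)
  define \<phi> where "\<phi> m = (case m of MV i j \<Rightarrow> d i j | MW i j \<Rightarrow> w i j | MU j \<Rightarrow> z)" for m
  have \<phi>_simps [simp]: "\<phi> (MV i j) = d i j" "\<phi> (MW i j) = w i j" "\<phi> (MU j) = z" for i j
    by (simp_all add: \<phi>_def)
  let ?M = "blown_up_mycielskian k a a 1"
  have vM: "verts ?M = {MV i j |i j. i < k \<and> j < a} \<union> {MW i j |i j. i < k \<and> j < a} \<union> {MU 0}"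
    by (auto simp: blown_up_mycielskian_def)
  have DD: "d i j \<noteq> d i' j'" if "i < k" "i' < k" "j < a" "j' < a" "i \<noteq> i'" for i i' j j'
    using multipartite_disjoint[OF D that(1,2,5)] d(2) that by (metis disjoint_iff)
  have WW: "w i j \<noteq> w i' j'" if "i < k" "i' < k" "j < a" "j' < a" "i \<noteq> i'" for i i' j j'
    using DW w(2) that by (metis disjoint_iff)
  \<comment> \<open>For equal indices disjointness is part of the configuration; for different
    indices the two vertices are adjacent, hence distinct.\<close>
  have dw: "d i j \<noteq> w i' j'" if "i < k" "i' < k" "j < a" "j' < a" for i i' j j'
  proof (cases "i = i'")
    case True
    then show ?thesis using W d(2) w(2) that by (metis disjoint_iff)
  next
    case False
    then have "{d i j, w i' j'} \<in> edges G" using DW d(2) w(2) that by metis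
    then show ?thesis using E_irrefl by metis
  qed
  have zd: "z \<noteq> d i j" "z \<noteq> w i j" if "i < k" "j < a" for i j
    using W d(2)[OF that] w(2)[OF that] that E_irrefl by metis+
  have d_eq: "d i j = d i' j' \<longleftrightarrow> i = i' \<and> j = j'" if "i < k" "i' < k" "j < a" "j' < a" for i i' j j'
    using DD[OF that] d(1)[OF that(1)] that by (auto dest: inj_onD)
  have w_eq: "w i j = w i' j' \<longleftrightarrow> i = i' \<and> j = j'" if "i < k" "i' < k" "j < a" "j' < a" for i i' j j'
    using WW[OF that] w(1)[OF that(1)] that by (auto dest: inj_onD)
  have "inj_on \<phi> (verts ?M)"
    unfolding vM using d_eq w_eq dw dw[symmetric] zd zd[symmetric]
    by (intro inj_onI) (elim UnE CollectE exE conjE singletonE; simp)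
  moreover have "\<phi> ` verts ?M \<subseteq> verts G"
  proof -
    \<comment> \<open>Membership of \<open>z\<close> is read off from an edge to \<open>W 0\<close>,
      which is nonempty because \<open>k\<close> and \<open>a\<close> are positive.\<close>
    have "z \<in> verts G"
      using W w(2)[OF pos] pos(1) E_V by blast
    moreover have "d i j \<in> verts G" "w i j \<in> verts G" if "i < k" "j < a" for i j
      using d(2)[OF that] w(2)[OF that] D W that unfolding multipartite_def by blast+
    ultimately show ?thesis unfolding vM by auto
  qed
  moreover have "\<forall>e\<in>edges ?M. \<phi> ` e \<in> edges G"
  proof -
    have "{d i j, d i' j'} \<in> edges G" if "i < k" "i' < k" "j < a" "j' < a" "i \<noteq> i'" for i i' j j'
      using D d(2) that unfolding multipartite_def by metis
    moreover have "{d i j, w i' j'} \<in> edges G" if "i < k" "i' < k" "j < a" "j' < a" "i \<noteq> i'" for i i' j j'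
      using DW d(2) w(2) that by metis
    moreover have "{w i j, z} \<in> edges G" if "i < k" "j < a" for i j
      using W w(2) that by (metis insert_commute)
    ultimately show ?thesis
      by (intro ballI) (erule blown_up_mycielskian_edgeE; simp)
  qed
  ultimately have "is_subgraph ?M G" unfolding is_subgraph_def by blast
  then show False using free is_subgraph_trans[OF M] by (auto simp: free_of_def)
qed

theorem theorem7:
  fixes H :: "'a graph" and k a :: nat and f :: "nat \<Rightarrow> real"
  assumes "simple_graph H"
    and "\<exists>e. critical_edge H e"
    and "chromatic_number H = k + 1"
    and "k + 1 \<ge> 3"
    and "a > 0"
    and "is_subgraph H (blown_up_mycielskian k a a 1)"
    and "\<And>n. f n \<ge> 0"
    and "f \<in> o(\<lambda>n. real n ^ 2)"
  shows "\<exists>C :: real. \<forall>\<^sub>F n in sequentially. \<forall>G :: 'b graph.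
           simple_graph G \<and> card (verts G) = n \<and> free_of H G \<and>
           real (card (edges G)) \<ge> real (turan_number k n) - f n \<longrightarrow>
           (\<exists>F. F \<subseteq> edges G \<and> real (card F) \<le> C * f n ^ 2 / real n ^ 2 \<and>
                k_partite k (delete_edges G F))"
proof -
  obtain e where e: "critical_edge H e" using assms(2) by blast
  have k: "k \<ge> 2" and k1: "k \<ge> 1" using assms(4) by simp_all
  \<comment> \<open>One parameter serves both exclusions: the order of \<open>H\<close> for
    \<open>crit_free\<close>, and \<open>a\<close> for \<open>myc_free\<close>.\<close>
  define t where "t = max (card (verts H)) a"
  have t: "t \<ge> 1" "card (verts H) \<le> t" "a \<le> t" using assms(5) by (auto simp: t_def)
  define \<gamma> where "\<gamma> = 1 / (16 * real k ^ 2 * t)"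
  have \<gamma>0: "\<gamma> > 0" using k t by (simp add: \<gamma>_def)
  have "\<gamma>\<^sup>2 / 16 > 0" using \<gamma>0 by simp
  from crit_free_stability[OF k this, of t, where 'b = 'b]
  obtain \<delta> n0 where \<delta>: "\<delta> > 0" and stab: "\<And>(V :: 'b set) E. fgraph V E \<Longrightarrow> crit_free V E k t \<Longrightarrow>
      n0 \<le> card V \<Longrightarrow> (1 - 1 / k - \<delta>) * real (card V) ^ 2 \<le> arcs E V \<Longrightarrow>
      \<exists>p. (\<forall>v. p v < k) \<and> card (inner_arcs E p) \<le> \<gamma>\<^sup>2 / 16 * real (card V) ^ 2"
    by blast
  \<comment> \<open>The total edge deficit is to stay below both the stability threshold \<delta>
    and the threshold of \<open>inner_arcs_bound\<close>.\<close>
  define \<eta> where "\<eta> = min \<delta> (\<gamma>\<^sup>2 / 16)"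
  have \<eta>0: "\<eta> > 0" using \<delta> \<gamma>0 by (simp add: \<eta>_def)
  have "\<forall>\<^sub>F n in sequentially. norm (f n) \<le> \<eta> / 4 * norm (real n ^ 2)"
    using landau_o.smallD[OF assms(8), of "\<eta> / 4"] \<eta>0 by simp
  moreover
  obtain N :: nat where N: "max (max (real n0) (8 * t / \<gamma>))
      (max (max (4 * k / \<gamma>) (4 * k * (real (k * t) + t + 1))) (max 1 (2 * k / \<eta>))) \<le> N"
    using real_arch_simple by blast
  have "\<forall>\<^sub>F n in sequentially. N \<le> n" by (rule eventually_ge_at_top)
  ultimately have "\<forall>\<^sub>F n in sequentially. \<forall>G :: 'b graph.
           simple_graph G \<and> card (verts G) = n \<and> free_of H G \<and>
           real (card (edges G)) \<ge> real (turan_number k n) - f n \<longrightarrow>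
           (\<exists>F. F \<subseteq> edges G \<and> real (card F) \<le> (64 * (real t + 1) / \<gamma>\<^sup>2) * f n ^ 2 / real n ^ 2 \<and>
                k_partite k (delete_edges G F))"
  proof eventually_elim
    case (elim n)
    have "real N \<le> n" using elim(2) by simp
    then have large: "real n0 \<le> n" "8 * t / \<gamma> \<le> n" "4 * k / \<gamma> \<le> n"
      "4 * k * (real (k * t) + t + 1) \<le> n" "1 \<le> real n" "2 * k / \<eta> \<le> n"
      using N by linarith+
    have fn: "f n \<le> \<eta> / 4 * real n ^ 2" using elim(1) assms(7)[of n] by simp
    have "real k \<le> \<eta> / 2 * n" using large(6) \<eta>0 by (simp add: field_simps)
    also have "\<dots> \<le> \<eta> / 2 * real n ^ 2"
      using large(5) \<eta>0 by (intro mult_left_mono) (auto simp: power2_eq_square)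
    finally have fk: "2 * f n + k \<le> \<eta> * real n ^ 2" using fn by simp
    show ?case
    proof (intro allI impI, elim conjE)
      fix G :: "'b graph"
      assume G: "simple_graph G" and cn: "card (verts G) = n" and free: "free_of H G"
        and eG: "real (card (edges G)) \<ge> real (turan_number k n) - f n"
      let ?E = "\<lambda>x y. {x, y} \<in> edges G"
      interpret fgraph "verts G" ?E by (rule simple_graph_fgraph[OF G])
      have cf: "crit_free (verts G) ?E k t"
        by (rule crit_free_if_free_of[OF assms(1) e assms(3) G free t(2)])
      have mf: "myc_free (verts G) ?E k t"
        by (rule myc_free_if_free_of[OF assms(6) G free t(3)]) (use k assms(5) in auto)
      have "(1 - 1 / k) * real n ^ 2 - k \<le> 2 * turan_number k n"
        using k by (intro turan_number_lower_bound) simp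
      then have low: "(1 - 1 / k) * real n ^ 2 - 2 * f n - k \<le> arcs ?E (verts G)"
        using eG arcs_eq_edges[OF G] by simp
      have "\<eta> * real n ^ 2 \<le> \<delta> * real n ^ 2" "\<eta> * real n ^ 2 \<le> \<gamma>\<^sup>2 / 16 * real n ^ 2"
        by (intro mult_right_mono; simp add: \<eta>_def)+
      then have f\<delta>: "2 * f n + k \<le> \<delta> * real n ^ 2" and f\<gamma>: "2 * f n + k \<le> \<gamma>\<^sup>2 / 16 * real n ^ 2"
        using fk by linarith+
      have "(1 - 1 / k - \<delta>) * real (card (verts G)) ^ 2 \<le> arcs ?E (verts G)"
        using low f\<delta> by (simp add: cn algebra_simps)
      then obtain p0 where p0: "\<And>v. p0 v < k" "card (inner_arcs ?E p0) \<le> \<gamma>\<^sup>2 / 16 * real n ^ 2"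
        using stab[OF fgraph_axioms cf] large(1) cn by auto
      obtain p where "\<forall>v. p v < k"
        "\<forall>q. (\<forall>v. q v < k) \<longrightarrow> card (inner_arcs ?E p) \<le> card (inner_arcs ?E q)"
        "\<forall>v. \<forall>i<k. card {w. ?E v w \<and> p w = p v} \<le> card {w. ?E v w \<and> p w = i}"
        by (rule min_inner_arcs[OF k1])
      note p = this[rule_format]
      \<comment> \<open>The minimiser inherits this bound from the partition \<open>p0\<close>
        provided by stability.\<close>
      have few: "card (inner_arcs ?E p) \<le> \<gamma>\<^sup>2 / 16 * real n ^ 2"
        using p(2)[of p0, OF p0(1)] p0(2) by linarith
      \<comment> \<open>The error term \<open>K\<close> is \<open>k\<close>, the loss in the
        estimate of the Turan number.\<close>
      have bound: "card (inner_arcs ?E p) \<le> 128 * (real t + 1) * (f n)\<^sup>2 / (\<gamma>\<^sup>2 * (real n)\<^sup>2)"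
        using inner_arcs_bound[OF k t(1) \<gamma>_def cf mf p(1) p(3), of "f n" k]
          few low f\<gamma> assms(7)[of n] large \<gamma>0 by (simp add: cn field_simps)
      define F where "F = {e \<in> edges G. \<exists>x y. e = {x, y} \<and> p x = p y}"
      have "{(x, y). {x, y} \<in> F} = inner_arcs ?E p"
        by (auto simp: F_def inner_arcs_def doubleton_eq_iff)
      moreover have "finite F" "\<And>e. e \<in> F \<Longrightarrow> card e = 2"
        using finite_edges[OF G] G by (auto simp: F_def simple_graph_def)
      \<comment> \<open>Each deleted edge is two arcs, which turns the constant 128 into 64.\<close>
      ultimately have cF: "2 * card F = card (inner_arcs ?E p)"
        using card_arcs_of_edges[of F] by simp
      have "real (card F) \<le> (64 * (real t + 1) / \<gamma>\<^sup>2) * f n ^ 2 / real n ^ 2"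
      proof -
        have "2 * real (card F) = card (inner_arcs ?E p)"
          using cF by linarith
        moreover have "128 * (real t + 1) * (f n)\<^sup>2 / (\<gamma>\<^sup>2 * (real n)\<^sup>2)
            = 2 * ((64 * (real t + 1) / \<gamma>\<^sup>2) * f n ^ 2 / real n ^ 2)"
          by simp
        ultimately show ?thesis using bound by linarith
      qed
      moreover have "k_partite k (delete_edges G F)"
        unfolding k_partite_def
      proof (intro exI[of _ "\<lambda>i. {v \<in> verts G. p v = i}"] conjI allI impI ballI notI)
        show "(\<Union>i<k. {v \<in> verts G. p v = i}) = verts (delete_edges G F)"
          using p(1) by (auto simp: delete_edges_def)
        show "disjoint_family_on (\<lambda>i. {v \<in> verts G. p v = i}) {..<k}"
          by (auto simp: disjoint_family_on_def)
        fix i e assume "i < k" "e \<in> edges (delete_edges G F)" "e \<subseteq> {v \<in> verts G. p v = i}"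
        then have e: "e \<in> edges G" "e \<notin> F" "e \<subseteq> {v. p v = i}" by (auto simp: delete_edges_def)
        obtain x y where "e = {x, y}"
          using G e(1) by (auto simp: simple_graph_def card_2_iff)
        then show False using e by (auto simp: F_def)
      qed
      moreover have "F \<subseteq> edges G" by (auto simp: F_def)
      ultimately show "\<exists>F. F \<subseteq> edges G \<and>
          real (card F) \<le> (64 * (real t + 1) / \<gamma>\<^sup>2) * f n ^ 2 / real n ^ 2 \<and>
          k_partite k (delete_edges G F)" by blast
    qed
  qed
  then show ?thesis by blast
qed

end
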